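(* Let $J$ be an integer and let $\mathsf{N}_j$, $j\ge J$, be $d\times d$ real-valued invertible matrices. Let $\mathbf{\Phi}=\{\boldsymbol\varphi^1,\ldots,\boldsymbol\varphi^r\}$, $\tilde{\mathbf{\Phi}}=\{\tilde{\boldsymbol\varphi}^1,\ldots,\tilde{\boldsymbol\varphi}^r\}$ and $\mathbf{\Psi}_j=\{\boldsymbol\psi^{j,1},\ldots,\boldsymbol\psi^{j,s_j}\}$, $\tilde{\mathbf{\Psi}}_j=\{\tilde{\boldsymbol\psi}^{j,1},\ldots,\tilde{\boldsymbol\psi}^{j,s_j}\}$ be at most countable subsets of distributions on $\mathbb{R}^d$ for all integers $j\ge J$. Then the pair $$(\mathsf{FWS}_J(\mathbf{\Phi};\{\mathbf{\Psi}_j\}_{j=J}^\infty),\ \mathsf{FWS}_J(\tilde{\mathbf{\Phi}};\{\tilde{\mathbf{\Psi}}_j\}_{j=J}^\infty))$$ is a pair of frequency-based nonstationary dual wavelet frames in $L_2(\mathbb{R}^d)$ if and only if (i) there exists a positive constant $C$ such that $$\sum_{\boldsymbol\varphi\in\mathbf{\Phi}}\sum_{k\in\mathbb{Z}^d}|\langle\mathbf{f},\boldsymbol\varphi_{\mathsf{N}_J;0,k}\rangle|^2+\sum_{j=J}^\infty\sum_{\boldsymbol\psi\in\mathbf{\Psi}_j}\sum_{k\in\mathbb{Z}^d}|\langle\mathbf{f},\boldsymbol\psi_{\mathsf{N}_j;0,k}\rangle|^2\le C\|\mathbf{f}\|^2_{L_2(\mathbb{R}^d)},\qquad\forall\mathbf{f}\in\mathscr{D}(\mathbb{R}^d),$$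 $$\sum_{\tilde{\boldsymbol\varphi}\in\tilde{\mathbf{\Phi}}}\sum_{k\in\mathbb{Z}^d}|\langle\mathbf{g},\tilde{\boldsymbol\varphi}_{\mathsf{N}_J;0,k}\rangle|^2+\sum_{j=J}^\infty\sum_{\tilde{\boldsymbol\psi}\in\tilde{\mathbf{\Psi}}_j}\sum_{k\in\mathbb{Z}^d}|\langle\mathbf{g},\tilde{\boldsymbol\psi}_{\mathsf{N}_j;0,k}\rangle|^2\le C\|\mathbf{g}\|^2_{L_2(\mathbb{R}^d)},\qquad\forall\mathbf{g}\in\mathscr{D}(\mathbb{R}^d);$$ and (ii) the pair is a pair of frequency-based nonstationary dual wavelet frames in the distribution space $\mathscr{D}'(\mathbb{R}^d)$.
   Context: $\mathscr{D}(\mathbb{R}^d)$ is the space of compactly supported $C^\infty$ functions with its usual topology and $\mathscr{D}'(\mathbb{R}^d)$ its dual. For a function $f$ on $\mathbb{R}^d$, a real invertible matrix $U$ and $k\in\mathbb{R}^d$, $f_{U;0,k}(\xi):=|\det U|^{1/2}e^{-ik\cdot U\xi}f(U\xi)$, extended to distributions by duality. For $\mathbf{f}\in\mathscr{D}(\mathbb{R}^d)$ and $\boldsymbol\psi\in\mathscr{D}'(\mathbb{R}^d)$: $\langle\boldsymbol\psi,\mathbf{f}\rangle:=\boldsymbol\psi(\overline{\mathbf{f}})$ and $\langle\mathbf{f},\boldsymbol\psi\rangle:=\overline{\langle\boldsymbol\psi,\mathbf{f}\rangle}$ (so $\langle\mathbf{f},\boldsymbol\psi\rangle=\int\mathbf{f}\,\overline{\boldsymbol\psi}$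 when $\boldsymbol\psi$ is locally integrable). Sets of generators are counted with multiplicity, with $r,s_j\in\mathbb{N}\cup\{0,+\infty\}$, and systems are indexed families. Define $$\mathsf{FWS}_J(\mathbf{\Phi};\{\mathbf{\Psi}_j\}_{j=J}^\infty)=\{\boldsymbol\varphi_{\mathsf{N}_J;0,k}:k\in\mathbb{Z}^d,\boldsymbol\varphi\in\mathbf{\Phi}\}\cup\bigcup_{j=J}^\infty\{\boldsymbol\psi_{\mathsf{N}_j;0,k}:k\in\mathbb{Z}^d,\boldsymbol\psi\in\mathbf{\Psi}_j\}.$$ Consider the identity $$( * )\quad\sum_{\ell=1}^r\sum_{k\in\mathbb{Z}^d}\langle\mathbf{f},\boldsymbol\varphi^\ell_{\mathsf{N}_J;0,k}\rangle\langle\tilde{\boldsymbol\varphi}^\ell_{\mathsf{N}_J;0,k},\mathbf{g}\rangle+\sum_{j=J}^\infty\sum_{\ell=1}^{s_j}\sum_{k\in\mathbb{Z}^d}\langle\mathbf{f},\boldsymbol\psi^{j,\ell}_{\mathsf{N}_j;0,k}\rangle\langle\tilde{\boldsymbol\psi}^{j,\ell}_{\mathsf{N}_j;0,k},\mathbf{g}\rangle=(2\pi)^d\langle\mathbf{f},\mathbf{g}\rangle.$$ The pair is a pair of frequency-based nonstationary dual wavelet frames in the distribution space $\mathscr{D}'(\mathbb{R}^d)$ if $( * )$ holds for all $\mathbf{f},\mathbf{g}\in\mathscr{D}(\mathbb{R}^d)$ in the following sense: the series $\sum_{\ell=1}^r\sum_k$ and, for each $j\ge J$, the series $\sum_{\ell=1}^{s_j}\sum_k$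 in $( * )$ converge absolutely, and the limit as $J'\to+\infty$ of the left-hand side of $( * )$ with $\sum_{j=J}^\infty$ replaced by $\sum_{j=J}^{J'-1}$ exists and equals $(2\pi)^d\langle\mathbf{f},\mathbf{g}\rangle$. The pair is a pair of frequency-based nonstationary dual wavelet frames in $L_2(\mathbb{R}^d)$ if all elements of the two systems belong to $L_2(\mathbb{R}^d)$, each of the two systems is a frame in $L_2(\mathbb{R}^d)$, and $( * )$ holds for all $\mathbf{f},\mathbf{g}\in L_2(\mathbb{R}^d)$ with the series converging absolutely. *)

theory Defs
  imports "HOL-Analysis.Analysis"
begin

section \<open>Test functions and distributions\<close>

definition partial_deriv :: "'n \<Rightarrow> (real^'n \<Rightarrow> complex) \<Rightarrow> real^'n \<Rightarrow> complex" where
  "partial_deriv i f x = frechet_derivative f (at x) (axis i 1)"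

definition partial_derivs :: "'n list \<Rightarrow> (real^'n \<Rightarrow> complex) \<Rightarrow> real^'n \<Rightarrow> complex" where
  "partial_derivs is f = foldr partial_deriv is f"

definition smooth :: "(real^'n \<Rightarrow> complex) \<Rightarrow> bool" where
  "smooth f \<longleftrightarrow> (\<forall>is x. partial_derivs is f differentiable (at x))"

definition supp :: "(real^'n \<Rightarrow> complex) \<Rightarrow> (real^'n) set" where
  "supp f = closure {x. f x \<noteq> 0}"

definition test_fun :: "(real^'n \<Rightarrow> complex) set" where
  "test_fun = {f. smooth f \<and> compact (supp f)}"

text \<open>The norms defining the Frechet topology on the test functions supported in a fixed
  compact set.\<close>

definition Cm_norm :: "nat \<Rightarrow> (real^'n \<Rightarrow> complex) \<Rightarrow> real" where
  "Cm_norm m f = (\<Sum>is | length is \<le> m. SUP x. cmod (partial_derivs is f x))"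

definition seminorm_on_test_fun :: "((real^'n \<Rightarrow> complex) \<Rightarrow> real) \<Rightarrow> bool" where
  "seminorm_on_test_fun p \<longleftrightarrow>
     (\<forall>f\<in>test_fun. \<forall>g\<in>test_fun. p (\<lambda>x. f x + g x) \<le> p f + p g) \<and>
     (\<forall>c. \<forall>f\<in>test_fun. p (\<lambda>x. c * f x) = cmod c * p f)"

text \<open>The topology of the test functions is the locally convex inductive limit topology. It is
  generated by all seminorms whose restriction to the test functions supported in K is
  continuous, for every compact set K.\<close>

definition continuous_seminorm :: "((real^'n \<Rightarrow> complex) \<Rightarrow> real) \<Rightarrow> bool" where
  "continuous_seminorm p \<longleftrightarrow> seminorm_on_test_fun p \<and>
     (\<forall>K. compact K \<longrightarrow> (\<exists>C m. \<forall>f\<in>test_fun. supp f \<subseteq> K \<longrightarrow> p f \<le> C * Cm_norm m f))"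

definition test_topology :: "(real^'n \<Rightarrow> complex) topology" where
  "test_topology = topology_generated_by
     {{g \<in> test_fun. p (\<lambda>x. g x - f x) < e} | p f e.
        continuous_seminorm p \<and> f \<in> test_fun \<and> 0 < e}"

text \<open>Functionals are total functions in HOL; only their values on test functions matter.\<close>

definition distributions :: "((real^'n \<Rightarrow> complex) \<Rightarrow> complex) set" where
  "distributions = {T.
     (\<forall>f\<in>test_fun. \<forall>g\<in>test_fun. T (\<lambda>x. f x + g x) = T f + T g) \<and>
     (\<forall>c. \<forall>f\<in>test_fun. T (\<lambda>x. c * f x) = c * T f) \<and>
     continuous_map test_topology euclidean T}"

definition dist_pair :: "((real^'n \<Rightarrow> complex) \<Rightarrow> complex) \<Rightarrow> (real^'n \<Rightarrow> complex) \<Rightarrow> complex" where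
  "dist_pair T f = T (\<lambda>x. cnj (f x))"

definition pair_dist :: "(real^'n \<Rightarrow> complex) \<Rightarrow> ((real^'n \<Rightarrow> complex) \<Rightarrow> complex) \<Rightarrow> complex" where
  "pair_dist f T = cnj (dist_pair T f)"


section \<open>Square integrable functions\<close>

definition L2 :: "(real^'n \<Rightarrow> complex) set" where
  "L2 = {f. f \<in> borel_measurable lborel \<and> integrable lborel (\<lambda>x. (cmod (f x))\<^sup>2)}"

definition L2_inner :: "(real^'n \<Rightarrow> complex) \<Rightarrow> (real^'n \<Rightarrow> complex) \<Rightarrow> complex" where
  "L2_inner f g = (LINT x|lborel. f x * cnj (g x))"

definition L2_norm :: "(real^'n \<Rightarrow> complex) \<Rightarrow> real" where
  "L2_norm f = sqrt (LINT x|lborel. (cmod (f x))\<^sup>2)"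

definition represents :: "(real^'n \<Rightarrow> complex) \<Rightarrow> ((real^'n \<Rightarrow> complex) \<Rightarrow> complex) \<Rightarrow> bool" where
  "represents u T \<longleftrightarrow> (\<forall>f\<in>test_fun. T f = (LINT x|lborel. u x * f x))"

definition dist_in_L2 :: "((real^'n \<Rightarrow> complex) \<Rightarrow> complex) \<Rightarrow> bool" where
  "dist_in_L2 T \<longleftrightarrow> (\<exists>u\<in>L2. represents u T)"

text \<open>The representing function is unique almost everywhere, so integrals involving it do not
  depend on the choice.\<close>

definition L2_rep :: "((real^'n \<Rightarrow> complex) \<Rightarrow> complex) \<Rightarrow> real^'n \<Rightarrow> complex" where
  "L2_rep T = (SOME u. u \<in> L2 \<and> represents u T)"

definition is_L2_frame :: "'i set \<Rightarrow> ('i \<Rightarrow> real^'n \<Rightarrow> complex) \<Rightarrow> bool" where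
  "is_L2_frame I e \<longleftrightarrow> (\<forall>i\<in>I. e i \<in> L2) \<and>
     (\<exists>A>0. \<exists>B>0. \<forall>f\<in>L2.
        ennreal (A * (L2_norm f)\<^sup>2) \<le> (\<Sum>\<^sub>\<infinity>i\<in>I. ennreal ((cmod (L2_inner f (e i)))\<^sup>2)) \<and>
        (\<Sum>\<^sub>\<infinity>i\<in>I. ennreal ((cmod (L2_inner f (e i)))\<^sup>2)) \<le> ennreal (B * (L2_norm f)\<^sup>2))"


section \<open>Frequency-based wavelet systems\<close>

definition int_vec :: "int^'n \<Rightarrow> real^'n" where
  "int_vec k = (\<chi> i. of_int (k $ i))"

text \<open>For a function u, the dilated and modulated function is
  \<open>u\<^bsub>U;0,k\<^esub> x = \<bar>det U\<bar> powr (1/2) * cis (- (int_vec k \<bullet> (U *v x))) * u (U *v x)\<close>.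
  The substitution y = U x turns the integral of \<open>u\<^bsub>U;0,k\<^esub> * f\<close> into the integral of u against
  \<open>adj_affine U k f\<close>; the Jacobian changes the exponent of the determinant to -1/2.\<close>

definition adj_affine :: "real^'n^'n \<Rightarrow> int^'n \<Rightarrow> (real^'n \<Rightarrow> complex) \<Rightarrow> real^'n \<Rightarrow> complex" where
  "adj_affine U k f y =
     of_real (\<bar>det U\<bar> powr (- 1/2)) * cis (- (int_vec k \<bullet> y)) * f (matrix_inv U *v y)"

definition dist_affine ::
    "real^'n^'n \<Rightarrow> int^'n \<Rightarrow> ((real^'n \<Rightarrow> complex) \<Rightarrow> complex) \<Rightarrow> (real^'n \<Rightarrow> complex) \<Rightarrow> complex" where
  "dist_affine U k T f = T (adj_affine U k f)"

text \<open>A family of r generators is indexed by the naturals below r, so that repetitions are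
  counted; r may be 0 or infinity.\<close>

definition gens :: "enat \<Rightarrow> nat set" where
  "gens r = {l. enat l < r}"

definition fws_index :: "int \<Rightarrow> enat \<Rightarrow> (int \<Rightarrow> enat) \<Rightarrow> (nat \<times> (int^'n) + int \<times> nat \<times> (int^'n)) set" where
  "fws_index J r s = (gens r \<times> UNIV) <+> (SIGMA j:{J..}. gens (s j) \<times> UNIV)"

definition FWS :: "int \<Rightarrow> (int \<Rightarrow> real^'n^'n) \<Rightarrow> (nat \<Rightarrow> (real^'n \<Rightarrow> complex) \<Rightarrow> complex) \<Rightarrow>
    (int \<Rightarrow> nat \<Rightarrow> (real^'n \<Rightarrow> complex) \<Rightarrow> complex) \<Rightarrow>
    (nat \<times> (int^'n) + int \<times> nat \<times> (int^'n)) \<Rightarrow> (real^'n \<Rightarrow> complex) \<Rightarrow> complex" where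
  "FWS J N \<phi> \<psi> = case_sum (\<lambda>(l, k). dist_affine (N J) k (\<phi> l))
                           (\<lambda>(j, l, k). dist_affine (N j) k (\<psi> j l))"

definition dual_frames_in_distributions ::
    "int \<Rightarrow> (int \<Rightarrow> real^'n^'n) \<Rightarrow> enat \<Rightarrow> (int \<Rightarrow> enat) \<Rightarrow>
     (nat \<Rightarrow> (real^'n \<Rightarrow> complex) \<Rightarrow> complex) \<Rightarrow> (int \<Rightarrow> nat \<Rightarrow> (real^'n \<Rightarrow> complex) \<Rightarrow> complex) \<Rightarrow>
     (nat \<Rightarrow> (real^'n \<Rightarrow> complex) \<Rightarrow> complex) \<Rightarrow> (int \<Rightarrow> nat \<Rightarrow> (real^'n \<Rightarrow> complex) \<Rightarrow> complex) \<Rightarrow> bool" where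
  "dual_frames_in_distributions J N r s \<phi> \<psi> \<phi>' \<psi>' \<longleftrightarrow>
     (\<forall>f\<in>test_fun. \<forall>g\<in>test_fun.
        let a = (\<lambda>(l, k). pair_dist f (dist_affine (N J) k (\<phi> l)) *
                          dist_pair (dist_affine (N J) k (\<phi>' l)) g);
            b = (\<lambda>j (l, k). pair_dist f (dist_affine (N j) k (\<psi> j l)) *
                            dist_pair (dist_affine (N j) k (\<psi>' j l)) g)
        in (\<lambda>i. cmod (a i)) summable_on (gens r \<times> UNIV) \<and>
           (\<forall>j\<ge>J. (\<lambda>i. cmod (b j i)) summable_on (gens (s j) \<times> UNIV)) \<and>
           ((\<lambda>J'. infsum a (gens r \<times> UNIV) + (\<Sum>j\<in>{J..<J'}. infsum (b j) (gens (s j) \<times> UNIV)))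
             \<longlongrightarrow> of_real ((2 * pi) ^ CARD('n)) * L2_inner f g) at_top)"

definition dual_frames_in_L2 ::
    "int \<Rightarrow> (int \<Rightarrow> real^'n^'n) \<Rightarrow> enat \<Rightarrow> (int \<Rightarrow> enat) \<Rightarrow>
     (nat \<Rightarrow> (real^'n \<Rightarrow> complex) \<Rightarrow> complex) \<Rightarrow> (int \<Rightarrow> nat \<Rightarrow> (real^'n \<Rightarrow> complex) \<Rightarrow> complex) \<Rightarrow>
     (nat \<Rightarrow> (real^'n \<Rightarrow> complex) \<Rightarrow> complex) \<Rightarrow> (int \<Rightarrow> nat \<Rightarrow> (real^'n \<Rightarrow> complex) \<Rightarrow> complex) \<Rightarrow> bool" where
  "dual_frames_in_L2 J N r s \<phi> \<psi> \<phi>' \<psi>' \<longleftrightarrow>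
     (\<forall>i\<in>fws_index J r s. dist_in_L2 (FWS J N \<phi> \<psi> i) \<and> dist_in_L2 (FWS J N \<phi>' \<psi>' i)) \<and>
     is_L2_frame (fws_index J r s) (\<lambda>i. L2_rep (FWS J N \<phi> \<psi> i)) \<and>
     is_L2_frame (fws_index J r s) (\<lambda>i. L2_rep (FWS J N \<phi>' \<psi>' i)) \<and>
     (\<forall>f\<in>L2. \<forall>g\<in>L2.
        let c = (\<lambda>i. L2_inner f (L2_rep (FWS J N \<phi> \<psi> i)) * L2_inner (L2_rep (FWS J N \<phi>' \<psi>' i)) g)
        in (\<lambda>i. cmod (c i)) summable_on fws_index J r s \<and>
           (\<Sum>\<^sub>\<infinity>(l, k)\<in>gens r \<times> UNIV. c (Inl (l, k))) +
           (\<Sum>\<^sub>\<infinity>j\<in>{J..}. \<Sum>\<^sub>\<infinity>(l, k)\<in>gens (s j) \<times> UNIV. c (Inr (j, l, k)))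
             = of_real ((2 * pi) ^ CARD('n)) * L2_inner f g)"

end

theory Submission
  imports Defs
begin

text \<open>
  The theorem separates a statement about the Hilbert space of square integrable functions into a
  bound and an identity that can be tested on smooth compactly supported functions. The bridge is
  a pair of facts about the test functions in this Hilbert space.

  The first fact is a Riesz representation. If (i) holds, every element T of one of the two systems
  satisfies \<open>\<bar>T f\<bar> \<le> \<surd>C \<parallel>f\<parallel>\<close> on test functions, so it is the integral against a square
  integrable function. Theorem \<open>L2_Riesz_on_subspace\<close> obtains this function as the limit of a
  sequence of test functions that minimizes \<open>\<parallel>f\<parallel>\<^sup>2 - 2 Re (T f)\<close>; the parallelogram law makes the
  sequence Cauchy.

  The second fact is the density of the test functions, \<open>test_fun_dense_L2\<close>. Applied to the functional
  \<open>\<langle>\<cdot>, f\<rangle>\<close>, the Riesz theorem gives a limit w of test functions such that f - w is orthogonal to all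
  test functions. A function orthogonal to all test functions has vanishing integral over every
  box, because suitable bump functions increase to the indicator of the box; hence it vanishes
  almost everywhere (\<open>AE_eq_0_if_orthogonal\<close>), and f = w.

  With both facts the equivalence is a continuity argument. The bound (i) passes from
  test functions to all square integrable f through finite partial sums (\<open>Bessel_on_L2\<close>). By
  Cauchy-Schwarz in \<open>l\<^sup>2\<close>, the series \<open>\<Sum> \<langle>f, e i\<rangle> \<langle>e' i, g\<rangle>\<close> then converges absolutely and is bounded by
  \<open>C \<parallel>f\<parallel> \<parallel>g\<parallel>\<close>. So the identity (ii) extends from test functions, one slot at a time
  (\<open>mixed_sum_extend\<close>). The lower frame bound comes for free: the identity with g = f and
  Cauchy-Schwarz give \<open>(2\<pi>)\<^sup>d \<parallel>f\<parallel>\<^sup>2 \<le> (\<Sum> \<bar>\<langle>f, e i\<rangle>\<bar>\<^sup>2)\<^sup>1\<^sup>/\<^sup>2 \<surd>C \<parallel>f\<parallel>\<close> (\<open>L2_frame_if_dual\<close>). Conversely, a pair of dual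
  frames in \<open>L2\<close> satisfies (i) with the larger upper frame bound, and (ii) by restriction. The
  difference between absolute convergence over all indices and the limit over scales
  disappears, since absolutely convergent series may be summed scale by scale.
\<close>

section \<open>Smooth functions and test functions\<close>

inductive_set lin_span :: "(real^'n \<Rightarrow> complex) set \<Rightarrow> (real^'n \<Rightarrow> complex) set" for B where
  zero: "(\<lambda>x. 0) \<in> lin_span B"
| add: "b \<in> B \<Longrightarrow> f \<in> lin_span B \<Longrightarrow> (\<lambda>x. c * b x + f x) \<in> lin_span B"

lemma lin_span_base: "b \<in> B \<Longrightarrow> (\<lambda>x. c * b x) \<in> lin_span B"
  using lin_span.add[OF _ lin_span.zero, of b B c] by simp

lemma lin_span_add:
  assumes "f \<in> lin_span B" "g \<in> lin_span B"
  shows "(\<lambda>x. f x + g x) \<in> lin_span B"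
  using assms
proof (induction f rule: lin_span.induct)
  case zero
  then show ?case by simp
next
  case (add b f c)
  then have "(\<lambda>x. c * b x + (f x + g x)) \<in> lin_span B" by (intro lin_span.add) auto
  then show ?case by (simp add: add.assoc)
qed

lemma lin_span_scale:
  assumes "f \<in> lin_span B"
  shows "(\<lambda>x. a * f x) \<in> lin_span B"
  using assms
proof (induction f rule: lin_span.induct)
  case zero
  then show ?case by (simp add: lin_span.zero)
next
  case (add b f c)
  then have "(\<lambda>x. (a * c) * b x + a * f x) \<in> lin_span B" by (intro lin_span.add) auto
  then show ?case by (simp add: algebra_simps)
qed

lemma lin_span_sum:
  assumes "finite I" "\<And>i. i \<in> I \<Longrightarrow> f i \<in> lin_span B"
  shows "(\<lambda>x. \<Sum>i\<in>I. f i x) \<in> lin_span B"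
  using assms by (induction I) (auto intro: lin_span.zero lin_span_add)

lemma partial_deriv_eqI:
  "(f has_derivative D) (at x) \<Longrightarrow> partial_deriv i f x = D (axis i 1)"
  unfolding partial_deriv_def by (metis frechet_derivative_at)

lemma partial_deriv_add:
  assumes "f differentiable at x" "g differentiable at x"
  shows "partial_deriv i (\<lambda>x. f x + g x) x = partial_deriv i f x + partial_deriv i g x"
  by (rule partial_deriv_eqI[THEN trans])
     (use assms in \<open>auto intro!: derivative_eq_intros simp: frechet_derivative_works partial_deriv_def\<close>)

lemma partial_deriv_mult:
  assumes "f differentiable at x" "g differentiable at x"
  shows "partial_deriv i (\<lambda>x. f x * g x) x = partial_deriv i f x * g x + f x * partial_deriv i g x"
  by (rule partial_deriv_eqI[THEN trans])
     (use assms in \<open>auto intro!: derivative_eq_intros simp: frechet_derivative_works partial_deriv_def\<close>)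

lemma partial_deriv_const: "partial_deriv i (\<lambda>x. c) x = 0"
  by (rule partial_deriv_eqI[THEN trans]) (auto intro!: derivative_eq_intros)

lemma partial_derivs_snoc: "partial_derivs (is @ [i]) f = partial_derivs is (partial_deriv i f)"
  by (simp add: partial_derivs_def)

lemma smooth_imp_differentiable: "smooth f \<Longrightarrow> f differentiable at x"
  unfolding smooth_def by (metis partial_derivs_def foldr.simps(1) id_apply)

lemma smooth_partial_deriv: "smooth f \<Longrightarrow> smooth (partial_deriv i f)"
  unfolding smooth_def by (metis partial_derivs_snoc)

text \<open>Smoothness is a statement about all iterated partial derivatives, so it calls for coinduction: a set
  of differentiable functions is smooth if differentiation does not lead out of its linear span.
  Products, linear substitutions, plane waves and the bump functions below are all instances,
  each with its own generating set B.\<close>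

lemma smooth_if_derivs_in_lin_span:
  assumes diff: "\<And>b x. b \<in> B \<Longrightarrow> b differentiable at x"
    and deriv: "\<And>b i. b \<in> B \<Longrightarrow> partial_deriv i b \<in> lin_span B"
    and "f \<in> lin_span B"
  shows "smooth f"
proof -
  have span_diff: "g differentiable at x" if "g \<in> lin_span B" for g x
    using that
  proof induction
    case (add b f c)
    then show ?case using diff[of b x] by (intro derivative_intros) auto
  qed simp
  have span_deriv: "partial_deriv i g \<in> lin_span B" if "g \<in> lin_span B" for g i
    using that
  proof induction
    case zero
    then show ?case using lin_span.zero by (simp add: partial_deriv_const[abs_def])
  next
    case (add b f c)
    have "partial_deriv i (\<lambda>x. c * b x + f x) = (\<lambda>x. c * partial_deriv i b x + partial_deriv i f x)"
    proof
      fix x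
      have b: "b differentiable at x" and f: "f differentiable at x"
        using add diff span_diff by auto
      then show "partial_deriv i (\<lambda>x. c * b x + f x) x = c * partial_deriv i b x + partial_deriv i f x"
        by (simp add: partial_deriv_add partial_deriv_mult partial_deriv_const)
    qed
    then show ?case using add deriv by (simp add: lin_span_add lin_span_scale)
  qed
  have "partial_derivs is f \<in> lin_span B" for "is"
    using assms(3) by (induction "is") (auto simp: partial_derivs_def span_deriv)
  then show ?thesis using span_diff by (auto simp: smooth_def)
qed

lemma smooth_if_generator:
  assumes "f \<in> B" "\<And>b x. b \<in> B \<Longrightarrow> b differentiable at x"
    "\<And>b i. b \<in> B \<Longrightarrow> partial_deriv i b \<in> lin_span B"
  shows "smooth f"
  using smooth_if_derivs_in_lin_span[of B f] lin_span_base[of f B 1] assms by simp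

lemma smooth_add:
  assumes "smooth f" "smooth g"
  shows "smooth (\<lambda>x. f x + g x)"
proof (rule smooth_if_derivs_in_lin_span[where B = "{f. smooth f}"])
  show "(\<lambda>x. f x + g x) \<in> lin_span {f. smooth f}"
    using lin_span_add[OF lin_span_base[of f _ 1] lin_span_base[of g _ 1]] assms by simp
  show "partial_deriv i b \<in> lin_span {f. smooth f}" if "b \<in> {f. smooth f}" for b i
    using that smooth_partial_deriv[of b i] lin_span_base[of "partial_deriv i b" _ 1] by simp
qed (auto intro: smooth_imp_differentiable)

lemma smooth_mult:
  assumes "smooth f" "smooth g"
  shows "smooth (\<lambda>x. f x * g x)"
proof (rule smooth_if_generator[where B = "{\<lambda>x. f x * g x |f g. smooth f \<and> smooth g}"])
  let ?B = "{\<lambda>x. f x * g x |f g. smooth f \<and> smooth g} :: (real^'n \<Rightarrow> complex) set"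
  fix b i assume "b \<in> ?B"
  then obtain f g where b: "b = (\<lambda>x. f x * g x)" and fg: "smooth f" "smooth g" by auto
  have "partial_deriv i b = (\<lambda>x. partial_deriv i f x * g x + f x * partial_deriv i g x)"
    unfolding b by (intro ext partial_deriv_mult smooth_imp_differentiable fg)
  moreover have "(\<lambda>x. 1 * (partial_deriv i f x * g x)) \<in> lin_span ?B"
                "(\<lambda>x. 1 * (f x * partial_deriv i g x)) \<in> lin_span ?B"
    using fg smooth_partial_deriv by (intro lin_span_base; blast)+
  ultimately show "partial_deriv i b \<in> lin_span ?B" using lin_span_add by fastforce
  show "b differentiable at x" for x
    unfolding b by (intro derivative_intros smooth_imp_differentiable fg)
qed (use assms in blast)

lemma smooth_const: "smooth (\<lambda>x. c)"
  by (rule smooth_if_generator[where B = "range (\<lambda>c x. c)"])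
     (auto simp: partial_deriv_const[abs_def] intro: lin_span.zero)

lemma smooth_prod:
  assumes "finite I" "\<And>i. i \<in> I \<Longrightarrow> smooth (f i)"
  shows "smooth (\<lambda>x. \<Prod>i\<in>I. f i x)"
  using assms by (induction I) (auto intro: smooth_const smooth_mult)

lemma smooth_cnj:
  assumes "smooth f"
  shows "smooth (\<lambda>x. cnj (f x))"
proof (rule smooth_if_generator[where B = "{\<lambda>x. cnj (f x) |f. smooth f}"])
  let ?B = "{\<lambda>x. cnj (f x) |f. smooth f} :: (real^'n \<Rightarrow> complex) set"
  have deriv: "((\<lambda>x. cnj (f x)) has_derivative (\<lambda>h. cnj (frechet_derivative f (at x) h))) (at x)"
    if "smooth f" for f :: "real^'n \<Rightarrow> complex" and x
    using smooth_imp_differentiable[OF that]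
    by (intro bounded_linear.has_derivative[OF bounded_linear_cnj]) (simp add: frechet_derivative_works)
  fix b assume "b \<in> ?B"
  then obtain f where b: "b = (\<lambda>x. cnj (f x))" and f: "smooth f" by auto
  show "b differentiable at x" for x
    unfolding b using deriv[OF f] by (auto simp: differentiable_def)
  have "partial_deriv i b = (\<lambda>x. 1 * cnj (partial_deriv i f x))" for i
    using partial_deriv_eqI[OF deriv[OF f]] by (auto simp: b partial_deriv_def)
  then show "partial_deriv i b \<in> lin_span ?B" for i
    using f smooth_partial_deriv[of f i] lin_span_base[of "\<lambda>x. cnj (partial_deriv i f x)" ?B 1] by auto
qed (use assms in auto)

text \<open>The chain rule writes a partial derivative of \<open>f \<circ> A\<close> as a combination of functions \<open>g \<circ> A\<close>,
  where g runs through the partial derivatives of f.\<close>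

lemma smooth_compose_matrix:
  fixes A :: "real^'n^'n"
  assumes "smooth f"
  shows "smooth (\<lambda>x. f (A *v x))"
proof (rule smooth_if_generator[where B = "{\<lambda>x. f (A *v x) |f. smooth f}"])
  let ?B = "{\<lambda>x. f (A *v x) |f. smooth f} :: (real^'n \<Rightarrow> complex) set"
  have deriv: "((\<lambda>x. f (A *v x)) has_derivative (\<lambda>h. frechet_derivative f (at (A *v x)) (A *v h))) (at x)"
    if "smooth f" for f :: "real^'n \<Rightarrow> complex" and x
  proof -
    have "((*v) A has_derivative (*v) A) (at x)"
      by (intro bounded_linear_imp_has_derivative matrix_vector_mul_bounded_linear)
    moreover have "(f has_derivative frechet_derivative f (at (A *v x))) (at (A *v x))"
      using frechet_derivative_works smooth_imp_differentiable[OF that] by blast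
    ultimately show ?thesis by (rule has_derivative_compose)
  qed
  fix b assume "b \<in> ?B"
  then obtain f where b: "b = (\<lambda>x. f (A *v x))" and f: "smooth f" by auto
  show "b differentiable at x" for x
    unfolding b using deriv[OF f] by (auto simp: differentiable_def)
  fix i
  have "partial_deriv i b x = (\<Sum>j\<in>UNIV. of_real (A $ j $ i) * partial_deriv j f (A *v x))" for x
  proof -
    let ?D = "frechet_derivative f (at (A *v x))"
    have lin: "linear ?D" by (rule linear_frechet_derivative) (rule smooth_imp_differentiable[OF f])
    have "partial_deriv i b x = ?D (A *v axis i 1)"
      using partial_deriv_eqI[OF deriv[OF f]] by (simp add: b)
    also have "A *v axis i 1 = (\<Sum>j\<in>UNIV. (A $ j $ i) *\<^sub>R axis j 1)"
      unfolding matrix_vector_mult_basis by (simp add: column_def vec_eq_iff axis_def if_distrib cong: if_cong)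
    also have "?D \<dots> = (\<Sum>j\<in>UNIV. A $ j $ i *\<^sub>R ?D (axis j 1))"
      by (simp add: linear_sum[OF lin] linear_scale[OF lin])
    finally show ?thesis by (simp add: partial_deriv_def scaleR_conv_of_real)
  qed
  moreover have "(\<lambda>x. \<Sum>j\<in>UNIV. of_real (A $ j $ i) * partial_deriv j f (A *v x)) \<in> lin_span ?B"
    using f smooth_partial_deriv by (intro lin_span_sum lin_span_base) auto
  ultimately show "partial_deriv i b \<in> lin_span ?B" by presburger
qed (use assms in auto)

lemma smooth_cis_inner:
  fixes w :: "real^'n"
  shows "smooth (\<lambda>x. cis (w \<bullet> x))"
proof (rule smooth_if_generator[where B = "{\<lambda>x. cis (w \<bullet> x)}"])
  have deriv: "((\<lambda>x. cis (w \<bullet> x)) has_derivative (\<lambda>h. (w \<bullet> h) *\<^sub>R (\<i> * cis (w \<bullet> x)))) (at x)" for x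
  proof -
    have "((\<lambda>x. \<i> * of_real (w \<bullet> x)) has_derivative (\<lambda>h. \<i> * of_real (w \<bullet> h))) (at x)"
      by (intro has_derivative_mult_right has_derivative_of_real bounded_linear_imp_has_derivative
            bounded_linear_inner_right)
    from has_derivative_compose[OF this DERIV_exp[unfolded has_field_derivative_def]]
    show ?thesis by (simp add: cis_conv_exp scaleR_conv_of_real mult_ac)
  qed
  fix b :: "real^'n \<Rightarrow> complex" assume b: "b \<in> {\<lambda>x. cis (w \<bullet> x)}"
  show "b differentiable at x" for x
    using b deriv by (auto simp: differentiable_def)
  have "partial_deriv i b = (\<lambda>x. (of_real (w $ i) * \<i>) * cis (w \<bullet> x))" for i
    using b partial_deriv_eqI[OF deriv] by (auto simp: scaleR_conv_of_real inner_axis)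
  then show "partial_deriv i b \<in> lin_span {\<lambda>x. cis (w \<bullet> x)}" for i
    using lin_span_base[of _ "{\<lambda>x. cis (w \<bullet> x)}"] by auto
qed simp

lemma test_funI:
  assumes "smooth f" "compact K" "{x. f x \<noteq> 0} \<subseteq> K"
  shows "f \<in> test_fun"
proof -
  have "supp f \<subseteq> K"
    unfolding supp_def using assms by (intro closure_minimal compact_imp_closed)
  then have "supp f = K \<inter> supp f" by blast
  moreover have "compact (K \<inter> supp f)"
    using assms by (intro compact_Int_closed) (auto simp: supp_def)
  ultimately show ?thesis using assms by (simp add: test_fun_def)
qed

lemma test_funD:
  assumes "f \<in> test_fun"
  shows "smooth f" "compact (supp f)" "{x. f x \<noteq> 0} \<subseteq> supp f"
  using assms by (auto simp: test_fun_def supp_def intro: closure_subset[THEN subsetD])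

lemma test_fun_add:
  assumes "f \<in> test_fun" "g \<in> test_fun"
  shows "(\<lambda>x. f x + g x) \<in> test_fun"
  using test_funD[OF assms(1)] test_funD[OF assms(2)] compact_Un[of "supp f" "supp g"]
  by (intro test_funI[where K = "supp f \<union> supp g"] smooth_add subsetI) (auto simp: subset_iff, metis add.left_neutral)

lemma test_fun_mult:
  assumes "smooth u" "f \<in> test_fun"
  shows "(\<lambda>x. u x * f x) \<in> test_fun"
  using test_funD[OF assms(2)] assms(1)
  by (intro test_funI[where K = "supp f"] smooth_mult) auto

lemma test_fun_scale: "f \<in> test_fun \<Longrightarrow> (\<lambda>x. c * f x) \<in> test_fun"
  by (rule test_fun_mult[OF smooth_const])

lemma test_fun_zero: "(\<lambda>x. 0) \<in> test_fun"
  by (simp add: test_fun_def smooth_const supp_def)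

lemma test_fun_cnj: "f \<in> test_fun \<Longrightarrow> (\<lambda>x. cnj (f x)) \<in> test_fun"
  by (simp add: test_fun_def smooth_cnj supp_def)

text \<open>The test functions are stable under the adjoint of dilation and modulation, so the elements
  of a wavelet system inherit linearity from their generators.\<close>

lemma test_fun_adj_affine:
  assumes "invertible U" "f \<in> test_fun"
  shows "adj_affine U k f \<in> test_fun"
proof -
  have "{y. f (matrix_inv U *v y) \<noteq> 0} \<subseteq> (*v) U ` supp f"
  proof
    fix y assume "y \<in> {y. f (matrix_inv U *v y) \<noteq> 0}"
    then have "matrix_inv U *v y \<in> supp f" using closure_subset by (force simp: supp_def)
    moreover have "y = U *v (matrix_inv U *v y)"
      using someI_ex[OF assms(1)[unfolded invertible_def]]
      by (simp add: matrix_vector_mul_assoc matrix_inv_def)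
    ultimately show "y \<in> (*v) U ` supp f" by blast
  qed
  moreover have "compact ((*v) U ` supp f)"
    using test_funD(2)[OF assms(2)]
    by (intro compact_continuous_image linear_continuous_on matrix_vector_mul_bounded_linear)
  ultimately have "(\<lambda>y. f (matrix_inv U *v y)) \<in> test_fun"
    using test_funD(1)[OF assms(2)] by (intro test_funI smooth_compose_matrix)
  from test_fun_scale[OF test_fun_mult[OF smooth_cis_inner[of "- int_vec k"] this]]
  show ?thesis by (simp add: adj_affine_def[abs_def] mult.assoc)
qed

section \<open>Bump functions that exhaust a box\<close>

text \<open>The extra factor \<open>inverse t ^ n\<close> closes the family under differentiation: a derivative is a
  combination of two members, which is what \<open>smooth_if_generator\<close> needs.\<close>

definition smooth_step :: "nat \<Rightarrow> real \<Rightarrow> real" where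
  "smooth_step n t = (if t > 0 then exp (- inverse t) * inverse t ^ n else 0)"

lemma smooth_step_at_0: "(smooth_step n \<longlongrightarrow> 0) (at 0)"
proof -
  have "((\<lambda>t::real. inverse t ^ n / exp (inverse t)) \<longlongrightarrow> 0) (at_right 0)"
    by (rule filterlim_compose[OF tendsto_power_div_exp_0 filterlim_inverse_at_top_right])
  then have "(smooth_step n \<longlongrightarrow> 0) (at_right 0)"
    by (rule Lim_transform_eventually)
       (auto simp: smooth_step_def eventually_at_filter exp_minus field_simps)
  moreover have "(smooth_step n \<longlongrightarrow> 0) (at_left 0)"
    by (rule Lim_transform_eventually[OF tendsto_const])
       (auto simp: smooth_step_def eventually_at_filter)
  ultimately show ?thesis by (simp add: filterlim_split_at)
qed

lemma DERIV_smooth_step: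
  "(smooth_step n has_real_derivative smooth_step (n + 2) t - real n * smooth_step (n + 1) t) (at t)"
proof -
  consider "t > 0" | "t < 0" | "t = 0" by linarith
  then show ?thesis
  proof cases
    case 1
    have "((\<lambda>t. exp (- inverse t) * inverse t ^ n) has_real_derivative
        smooth_step (n + 2) t - real n * smooth_step (n + 1) t) (at t)"
      by (rule DERIV_cong[OF DERIV_mult[OF DERIV_chain2[OF DERIV_exp DERIV_minus[OF DERIV_inverse]]
              DERIV_power[OF DERIV_inverse]]])
         (use 1 in \<open>cases n; simp add: smooth_step_def power2_eq_square algebra_simps\<close>)+
    then show ?thesis
      by (rule has_field_derivative_transform_within_open[where S = "{0<..}"])
         (use 1 in \<open>auto simp: smooth_step_def\<close>)
  next
    case 2
    have "((\<lambda>t. 0) has_real_derivative 0) (at t)" by simp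
    then have "(smooth_step n has_real_derivative 0) (at t)"
      by (rule has_field_derivative_transform_within_open[where S = "{..<0}"])
         (use 2 in \<open>auto simp: smooth_step_def\<close>)
    with 2 show ?thesis by (simp add: smooth_step_def)
  next
    case 3
    have "((\<lambda>h. (smooth_step n (0 + h) - smooth_step n 0) / h) \<longlongrightarrow> 0) (at 0)"
      by (rule Lim_transform_eventually[OF smooth_step_at_0[of "Suc n"]])
         (auto simp: smooth_step_def eventually_at_filter field_simps)
    then show ?thesis using 3 by (simp add: DERIV_def smooth_step_def)
  qed
qed

lemma smooth_step_coordinate:
  fixes i :: "'n::finite"
  shows "smooth (\<lambda>x::real^'n. of_real (smooth_step n (p * x $ i + q)))"
proof (rule smooth_if_generator[where
      B = "range (\<lambda>n x::real^'n. of_real (smooth_step n (p * x $ i + q)))"])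
  let ?b = "\<lambda>n x::real^'n. complex_of_real (smooth_step n (p * x $ i + q))"
  let ?d = "\<lambda>n x. smooth_step (n + 2) (p * x $ i + q) - real n * smooth_step (n + 1) (p * x $ i + q)"
  have deriv: "(?b n has_derivative (\<lambda>h. of_real (?d n x * (p * h $ i)))) (at x)" for n x
  proof -
    have "((\<lambda>x::real^'n. p * x $ i + q) has_derivative (\<lambda>h. p * h $ i)) (at x)"
      by (rule derivative_eq_intros bounded_linear_imp_has_derivative bounded_linear_vec_nth refl | simp)+
    from has_derivative_compose[OF this DERIV_smooth_step[unfolded has_field_derivative_def]]
    show ?thesis by (rule has_derivative_of_real)
  qed
  fix b assume "b \<in> range ?b"
  then obtain n where b: "b = ?b n" by auto
  show "b differentiable at x" for x
    unfolding b using deriv by (auto simp: differentiable_def)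
  fix j
  define e where "e = complex_of_real (p * axis j 1 $ i)"
  have "partial_deriv j b = (\<lambda>x. e * ?b (n + 2) x + (- e * of_nat n) * ?b (n + 1) x)"
    unfolding b by (intro ext partial_deriv_eqI[OF deriv, THEN trans]) (simp add: e_def algebra_simps)
  moreover have "(\<lambda>x. e * ?b (n + 2) x) \<in> lin_span (range ?b)"
    "(\<lambda>x. (- e * of_nat n) * ?b (n + 1) x) \<in> lin_span (range ?b)"
    by (intro lin_span_base rangeI)+
  ultimately show "partial_deriv j b \<in> lin_span (range ?b)" using lin_span_add by fastforce
qed auto

text \<open>A product of one-dimensional steps in both directions of each coordinate. The dilation by m
  lets the steps converge to indicators of half-lines.\<close>

definition bump :: "real^'n \<Rightarrow> real^'n \<Rightarrow> nat \<Rightarrow> real^'n \<Rightarrow> complex" where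
  "bump a b m x = (\<Prod>i\<in>UNIV. of_real (smooth_step 0 (real m * (x $ i - a $ i))) *
                              of_real (smooth_step 0 (real m * (b $ i - x $ i))))"

lemma smooth_step_0_cases: "0 \<le> smooth_step 0 t" "smooth_step 0 t \<le> 1"
  by (auto simp: smooth_step_def)

lemma bump_outside:
  assumes "x \<notin> box a b"
  shows "bump a b m x = 0"
proof -
  obtain i where "x $ i \<le> a $ i \<or> b $ i \<le> x $ i"
    using assms by (auto simp: mem_box_cart not_less)
  then have "smooth_step 0 (real m * (x $ i - a $ i)) = 0 \<or> smooth_step 0 (real m * (b $ i - x $ i)) = 0"
    by (auto simp: smooth_step_def zero_less_mult_iff)
  then show ?thesis unfolding bump_def by (intro prod_zero) auto
qed

lemma norm_bump_le: "cmod (bump a b m x) \<le> 1"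
  unfolding bump_def using smooth_step_0_cases
  by (auto simp: norm_mult prod_norm[symmetric] intro!: prod_le_1 mult_le_one)

lemma bump_test_fun: "bump a b m \<in> test_fun"
proof -
  have "smooth (\<lambda>x. complex_of_real (smooth_step 0 (real m * (x $ i - a $ i))))" for i
    using smooth_step_coordinate[of 0 "real m" i "- real m * a $ i"] by (simp add: algebra_simps)
  moreover have "smooth (\<lambda>x. complex_of_real (smooth_step 0 (real m * (b $ i - x $ i))))" for i
    using smooth_step_coordinate[of 0 "- real m" i "real m * b $ i"] by (simp add: algebra_simps)
  ultimately have "smooth (bump a b m)"
    unfolding bump_def[abs_def] by (intro smooth_prod smooth_mult) auto
  moreover have "{x. bump a b m x \<noteq> 0} \<subseteq> cbox a b"
    using bump_outside box_subset_cbox by blast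
  ultimately show ?thesis by (rule test_funI[OF _ compact_cbox])
qed

lemma bump_tendsto:
  fixes a b x :: "real^'n"
  shows "(\<lambda>m. bump a b m x) \<longlonglongrightarrow> indicator (box a b) x"
proof (cases "x \<in> box a b")
  case False
  then show ?thesis by (simp add: bump_outside)
next
  case True
  have step: "(\<lambda>m. smooth_step 0 (real m * t)) \<longlonglongrightarrow> 1" if "t > 0" for t
  proof -
    have "(\<lambda>m. exp (- (inverse (real m) * inverse t))) \<longlonglongrightarrow> exp (- (0 * inverse t))"
      by (intro tendsto_intros lim_inverse_n)
    then have "(\<lambda>m. exp (- (inverse (real m) * inverse t))) \<longlonglongrightarrow> 1" by simp
    then show ?thesis
      by (rule Lim_transform_eventually)
         (use that in \<open>auto simp: smooth_step_def eventually_sequentially intro!: exI[of _ 1]\<close>)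
  qed
  have "(\<lambda>m. bump a b m x) \<longlonglongrightarrow> (\<Prod>i::'n\<in>UNIV. of_real 1 * of_real 1)"
    unfolding bump_def
    by (intro tendsto_prod tendsto_mult tendsto_of_real step) (use True in \<open>auto simp: mem_box_cart\<close>)
  then show ?thesis using True by simp
qed

section \<open>The inner product of square integrable functions\<close>

lemma L2I: "f \<in> borel_measurable lborel \<Longrightarrow> integrable lborel (\<lambda>x. (cmod (f x))\<^sup>2) \<Longrightarrow> f \<in> L2"
  by (simp add: L2_def)

lemma L2_measurable: "f \<in> L2 \<Longrightarrow> f \<in> borel_measurable lborel"
  by (simp add: L2_def)

lemma L2_integrable_square: "f \<in> L2 \<Longrightarrow> integrable lborel (\<lambda>x. (cmod (f x))\<^sup>2)"
  by (simp add: L2_def)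

lemma L2_scale:
  assumes "f \<in> L2"
  shows "(\<lambda>x. c * f x) \<in> L2"
proof (rule L2I)
  show "(\<lambda>x. c * f x) \<in> borel_measurable lborel"
    using L2_measurable[OF assms] by measurable
qed (simp add: norm_mult power_mult_distrib L2_integrable_square[OF assms])

lemma L2_add:
  assumes "f \<in> L2" "g \<in> L2"
  shows "(\<lambda>x. f x + g x) \<in> L2"
proof (rule L2I)
  have [measurable]: "f \<in> borel_measurable lborel" "g \<in> borel_measurable lborel"
    by (rule L2_measurable, fact)+
  show "(\<lambda>x. f x + g x) \<in> borel_measurable lborel" by measurable
  have "(cmod (f x + g x))\<^sup>2 \<le> 2 * (cmod (f x))\<^sup>2 + 2 * (cmod (g x))\<^sup>2" for x
  proof -
    have "(cmod (f x + g x))\<^sup>2 \<le> (cmod (f x) + cmod (g x))\<^sup>2"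
      by (intro power_mono norm_triangle_ineq) auto
    also have "\<dots> \<le> 2 * (cmod (f x))\<^sup>2 + 2 * (cmod (g x))\<^sup>2"
      using sum_squares_bound[of "cmod (f x)" "cmod (g x)"] by (simp add: power2_sum)
    finally show ?thesis .
  qed
  note bound = this
  show "integrable lborel (\<lambda>x. (cmod (f x + g x))\<^sup>2)"
  proof (rule Bochner_Integration.integrable_bound)
    show "integrable lborel (\<lambda>x. 2 * (cmod (f x))\<^sup>2 + 2 * (cmod (g x))\<^sup>2)"
      by (intro Bochner_Integration.integrable_add integrable_mult_right L2_integrable_square assms)
    show "AE x in lborel. norm ((cmod (f x + g x))\<^sup>2) \<le> norm (2 * (cmod (f x))\<^sup>2 + 2 * (cmod (g x))\<^sup>2)"
      using bound by (intro AE_I2) simp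
  qed measurable
qed

lemma L2_diff:
  assumes "f \<in> L2" "g \<in> L2"
  shows "(\<lambda>x. f x - g x) \<in> L2"
  using L2_add[OF assms(1) L2_scale[OF assms(2), of "-1"]] by simp

lemma L2_cnj:
  assumes "f \<in> L2"
  shows "(\<lambda>x. cnj (f x)) \<in> L2"
proof (rule L2I)
  show "(\<lambda>x. cnj (f x)) \<in> borel_measurable lborel"
    by (rule measurable_compose[OF L2_measurable[OF assms]])
       (intro borel_measurable_continuous_onI continuous_on_cnj continuous_on_id)
qed (simp add: L2_integrable_square[OF assms])

lemma L2_integrable_mult:
  assumes "f \<in> L2" "g \<in> L2"
  shows "integrable lborel (\<lambda>x. f x * g x)"
proof -
  have [measurable]: "f \<in> borel_measurable lborel" "g \<in> borel_measurable lborel"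
    by (rule L2_measurable, fact)+
  have bound: "norm (f x * g x) \<le> norm ((cmod (f x))\<^sup>2 + (cmod (g x))\<^sup>2)" for x
  proof -
    have "0 \<le> cmod (f x) * cmod (g x)" by simp
    then show ?thesis
      using sum_squares_bound[of "cmod (f x)" "cmod (g x)"] unfolding norm_mult real_norm_def by linarith
  qed
  show ?thesis
  proof (rule Bochner_Integration.integrable_bound)
    show "integrable lborel (\<lambda>x. (cmod (f x))\<^sup>2 + (cmod (g x))\<^sup>2)"
      by (intro Bochner_Integration.integrable_add L2_integrable_square assms)
    show "AE x in lborel. norm (f x * g x) \<le> norm ((cmod (f x))\<^sup>2 + (cmod (g x))\<^sup>2)"
      by (intro AE_I2 bound)
  qed measurable
qed

lemma L2_integrable_inner:
  "f \<in> L2 \<Longrightarrow> g \<in> L2 \<Longrightarrow> integrable lborel (\<lambda>x. f x * cnj (g x))"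
  by (intro L2_integrable_mult L2_cnj)

lemma L2_inner_add_left:
  "f \<in> L2 \<Longrightarrow> g \<in> L2 \<Longrightarrow> h \<in> L2 \<Longrightarrow> L2_inner (\<lambda>x. f x + g x) h = L2_inner f h + L2_inner g h"
  by (simp add: L2_inner_def distrib_right L2_integrable_inner)

lemma L2_inner_diff_left:
  "f \<in> L2 \<Longrightarrow> g \<in> L2 \<Longrightarrow> h \<in> L2 \<Longrightarrow> L2_inner (\<lambda>x. f x - g x) h = L2_inner f h - L2_inner g h"
  by (simp add: L2_inner_def left_diff_distrib L2_integrable_inner)

lemma L2_inner_scale_left: "L2_inner (\<lambda>x. c * f x) g = c * L2_inner f g"
  by (simp add: L2_inner_def mult.assoc)

lemma L2_inner_commute: "L2_inner f g = cnj (L2_inner g f)"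
  unfolding L2_inner_def by (subst Bochner_Integration.integral_cnj[symmetric]) (simp add: mult.commute)

lemma L2_inner_diff_right:
  "f \<in> L2 \<Longrightarrow> g \<in> L2 \<Longrightarrow> h \<in> L2 \<Longrightarrow> L2_inner h (\<lambda>x. f x - g x) = L2_inner h f - L2_inner h g"
  by (subst (1 2 3) L2_inner_commute) (simp add: L2_inner_diff_left)

lemma L2_norm_nonneg: "0 \<le> L2_norm f"
  by (simp add: L2_norm_def)

lemma L2_norm_square: "(L2_norm f)\<^sup>2 = (LINT x|lborel. (cmod (f x))\<^sup>2)"
  by (simp add: L2_norm_def)

lemma L2_norm_square_inner: "complex_of_real ((L2_norm f)\<^sup>2) = L2_inner f f"
  unfolding L2_norm_square L2_inner_def complex_norm_square[symmetric]
  by (simp only: integral_complex_of_real)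

lemma L2_norm_scale: "L2_norm (\<lambda>x. c * f x) = cmod c * L2_norm f"
  by (simp add: L2_norm_def norm_mult power_mult_distrib real_sqrt_mult)

lemma L2_norm_cnj: "L2_norm (\<lambda>x. cnj (f x)) = L2_norm f"
  by (simp add: L2_norm_def)

lemma L2_norm_minus_commute: "L2_norm (\<lambda>x. f x - g x) = L2_norm (\<lambda>x. g x - f x)"
  by (simp add: L2_norm_def norm_minus_commute)

lemma L2_norm_add_square:
  assumes "f \<in> L2" "g \<in> L2"
  shows "(L2_norm (\<lambda>x. f x + g x))\<^sup>2 = (L2_norm f)\<^sup>2 + 2 * Re (L2_inner g f) + (L2_norm g)\<^sup>2"
proof -
  have "(cmod (f x + g x))\<^sup>2 = (cmod (f x))\<^sup>2 + 2 * Re (g x * cnj (f x)) + (cmod (g x))\<^sup>2" for x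
    unfolding cmod_power2 by (simp add: algebra_simps power2_eq_square)
  then have "(L2_norm (\<lambda>x. f x + g x))\<^sup>2 =
    (LINT x|lborel. (cmod (f x))\<^sup>2 + 2 * Re (g x * cnj (f x)) + (cmod (g x))\<^sup>2)"
    by (simp only: L2_norm_square)
  also have "\<dots> = (L2_norm f)\<^sup>2 + 2 * Re (L2_inner g f) + (L2_norm g)\<^sup>2"
    using L2_integrable_inner[OF assms(2,1)] assms
    by (simp add: L2_integrable_square L2_norm_square L2_inner_def del: times_complex.sel)
  finally show ?thesis .
qed

lemma L2_norm_diff_square:
  assumes "f \<in> L2" "g \<in> L2"
  shows "(L2_norm (\<lambda>x. f x - g x))\<^sup>2 = (L2_norm f)\<^sup>2 - 2 * Re (L2_inner g f) + (L2_norm g)\<^sup>2"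
  using L2_norm_add_square[OF assms(1) L2_scale[OF assms(2), of "-1"]] L2_norm_scale[of "-1" g]
    L2_inner_scale_left[of "-1" g f] by simp

lemma nn_integral_L2_square:
  "f \<in> L2 \<Longrightarrow> (\<integral>\<^sup>+x. ennreal ((cmod (f x))\<^sup>2) \<partial>lborel) = ennreal ((L2_norm f)\<^sup>2)"
  by (simp add: L2_norm_square nn_integral_eq_integral L2_integrable_square)

lemma L2_Cauchy_Schwarz:
  assumes "f \<in> L2" "g \<in> L2"
  shows "cmod (L2_inner f g) \<le> L2_norm f * L2_norm g"
proof -
  have [measurable]: "f \<in> borel_measurable lborel" "g \<in> borel_measurable lborel"
    by (rule L2_measurable, fact)+
  have "ennreal (cmod (L2_inner f g)) \<le> (\<integral>\<^sup>+x. ennreal (cmod (f x)) * ennreal (cmod (g x)) \<partial>lborel)"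
    using integral_norm_bound_ennreal[OF L2_integrable_inner[OF assms]]
    by (simp add: L2_inner_def norm_mult ennreal_mult)
  then have "(ennreal (cmod (L2_inner f g)))\<^sup>2 \<le> (\<integral>\<^sup>+x. ennreal (cmod (f x)) * ennreal (cmod (g x)) \<partial>lborel)\<^sup>2"
    by (intro power_mono) auto
  also have "\<dots> \<le> (\<integral>\<^sup>+x. (ennreal (cmod (f x)))\<^sup>2 \<partial>lborel) * (\<integral>\<^sup>+x. (ennreal (cmod (g x)))\<^sup>2 \<partial>lborel)"
    by (rule Cauchy_Schwarz_nn_integral) auto
  also have "\<dots> = ennreal ((L2_norm f * L2_norm g)\<^sup>2)"
    by (simp add: ennreal_power nn_integral_L2_square assms power_mult_distrib ennreal_mult)
  finally have "(cmod (L2_inner f g))\<^sup>2 \<le> (L2_norm f * L2_norm g)\<^sup>2"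
    by (simp add: ennreal_power)
  then show ?thesis
    by (rule power2_le_imp_le) (simp add: L2_norm_nonneg)
qed

section \<open>Completeness and Riesz representation\<close>

text \<open>Squares that decay geometrically on average have summable roots, since the finite weighted sum
  M gives \<open>d k \<le> \<surd>M * (1/\<surd>2) ^ k\<close>.\<close>

lemma summable_if_weighted_squares_finite:
  fixes d :: "nat \<Rightarrow> real"
  assumes d: "\<And>k. 0 \<le> d k" and fin: "(\<Sum>k. ennreal (2 ^ k * (d k)\<^sup>2)) \<noteq> \<infinity>"
  shows "summable d"
proof -
  have summable: "summable (\<lambda>k. 2 ^ k * (d k)\<^sup>2)"
    using fin by (intro summable_suminf_not_top) auto
  define M where "M = (\<Sum>k. 2 ^ k * (d k)\<^sup>2)"
  have "d k \<le> sqrt M * (sqrt (1 / 2)) ^ k" for k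
  proof -
    have "2 ^ k * (d k)\<^sup>2 \<le> M"
      unfolding M_def using sum_le_suminf[OF summable, of "{k}"] by simp
    then have "(d k)\<^sup>2 \<le> M * (1 / 2) ^ k" by (simp add: field_simps)
    then have "d k \<le> sqrt (M * (1 / 2) ^ k)" by (rule real_le_rsqrt)
    then show ?thesis by (simp add: real_sqrt_mult real_sqrt_power)
  qed
  moreover have "summable (\<lambda>k. sqrt M * (sqrt (1 / 2)) ^ k)"
    by (intro summable_mult summable_geometric) (simp add: real_sqrt_lt_1_iff real_sqrt_divide)
  ultimately show ?thesis
    using d by (intro summable_comparison_test'[of "\<lambda>k. sqrt M * (sqrt (1 / 2)) ^ k" 0 d]) auto
qed

text \<open>Completeness, for sequences with a prescribed geometric rate of convergence. The rate makes
  \<open>\<Sum> 2 ^ k * \<bar>F k - F (k + 1)\<bar>\<^sup>2\<close> integrable, hence finite almost everywhere, so that the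
  sequence converges pointwise almost everywhere; Fatou's lemma carries the norm bounds to the
  limit.\<close>

lemma L2_complete_geometric:
  fixes F :: "nat \<Rightarrow> real^'n \<Rightarrow> complex"
  assumes F: "\<And>k. F k \<in> L2"
    and close: "\<And>k l. k \<le> l \<Longrightarrow> (L2_norm (\<lambda>x. F k x - F l x))\<^sup>2 \<le> c * (1 / 4) ^ k"
  obtains w where "w \<in> L2" "\<And>k. (L2_norm (\<lambda>x. F k x - w x))\<^sup>2 \<le> c * (1 / 4) ^ k"
proof -
  have [measurable]: "F k \<in> borel_measurable lborel" for k
    using F by (rule L2_measurable)
  have c: "0 \<le> c"
    using close[of 0 0] by (simp add: L2_norm_def)
  define w where "w x = lim (\<lambda>k. F k x)" for x
  have [measurable]: "w \<in> borel_measurable lborel"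
    unfolding w_def by measurable
  have lim: "AE x in lborel. (\<lambda>k. F k x) \<longlonglongrightarrow> w x"
  proof -
    let ?d = "\<lambda>k x. 2 ^ k * (cmod (F k x - F (Suc k) x))\<^sup>2"
    have "(\<integral>\<^sup>+x. (\<Sum>k. ennreal (?d k x)) \<partial>lborel) = (\<Sum>k. (\<integral>\<^sup>+x. ennreal (?d k x) \<partial>lborel))"
      by (rule nn_integral_suminf) measurable
    also have "\<dots> \<le> (\<Sum>k. ennreal (c * (1 / 2) ^ k))"
    proof (intro suminf_le)
      fix k
      have "(\<integral>\<^sup>+x. ennreal (?d k x) \<partial>lborel) = ennreal (2 ^ k) * ennreal ((L2_norm (\<lambda>x. F k x - F (Suc k) x))\<^sup>2)"
        using nn_integral_L2_square[OF L2_diff[OF F[of k] F[of "Suc k"]]]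
        by (simp add: ennreal_mult nn_integral_cmult)
      also have "\<dots> \<le> ennreal (2 ^ k) * ennreal (c * (1 / 4) ^ k)"
        by (intro mult_left_mono ennreal_leI close) auto
      also have "\<dots> = ennreal (c * (1 / 2) ^ k)"
      proof -
        have "(2::real) ^ k * (1 / 4) ^ k = (1 / 2) ^ k" unfolding power_mult_distrib[symmetric] by simp
        then show ?thesis using c by (simp add: ennreal_mult[symmetric] mult.left_commute)
      qed
      finally show "(\<integral>\<^sup>+x. ennreal (?d k x) \<partial>lborel) \<le> ennreal (c * (1 / 2) ^ k)" .
    qed auto
    also have "\<dots> < \<infinity>"
      using c by (subst suminf_ennreal2) (auto intro!: summable_mult summable_geometric)
    finally have "AE x in lborel. (\<Sum>k. ennreal (?d k x)) \<noteq> \<infinity>"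
      by (intro nn_integral_PInf_AE) auto
    then show ?thesis
    proof eventually_elim
      case (elim x)
      have "summable (\<lambda>k. cmod (F k x - F (Suc k) x))"
        by (rule summable_if_weighted_squares_finite) (use elim in auto)
      then have "summable (\<lambda>k. F (Suc k) x - F k x)"
        by (intro summable_norm_cancel[of "\<lambda>k. F (Suc k) x - F k x"]) (simp add: norm_minus_commute)
      then have "convergent (\<lambda>n. F n x - F 0 x)"
        by (simp add: summable_iff_convergent sum_lessThan_telescope[of "\<lambda>k. F k x"])
      then have "convergent (\<lambda>n. F n x)"
        using convergent_add[OF _ convergent_const[of "F 0 x"]] by fastforce
      then show ?case by (simp add: w_def convergent_LIMSEQ_iff)
    qed
  qed
  have bound: "(\<integral>\<^sup>+x. ennreal ((cmod (F k x - w x))\<^sup>2) \<partial>lborel) \<le> ennreal (c * (1 / 4) ^ k)" for k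
  proof -
    have "(\<integral>\<^sup>+x. ennreal ((cmod (F k x - w x))\<^sup>2) \<partial>lborel) =
      (\<integral>\<^sup>+x. liminf (\<lambda>l. ennreal ((cmod (F k x - F l x))\<^sup>2)) \<partial>lborel)"
    proof (rule nn_integral_cong_AE, use lim in eventually_elim)
      case (elim x)
      have "(\<lambda>l. ennreal ((cmod (F k x - F l x))\<^sup>2)) \<longlonglongrightarrow> ennreal ((cmod (F k x - w x))\<^sup>2)"
        by (intro tendsto_ennrealI tendsto_intros elim)
      then show ?case by (rule lim_imp_Liminf[OF trivial_limit_sequentially, symmetric])
    qed
    also have "\<dots> \<le> liminf (\<lambda>l. \<integral>\<^sup>+x. ennreal ((cmod (F k x - F l x))\<^sup>2) \<partial>lborel)"
      by (rule nn_integral_liminf) measurable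
    also have "\<dots> \<le> ennreal (c * (1 / 4) ^ k)"
    proof (rule Liminf_le)
      show "\<forall>\<^sub>F l in sequentially. (\<integral>\<^sup>+x. ennreal ((cmod (F k x - F l x))\<^sup>2) \<partial>lborel) \<le> ennreal (c * (1 / 4) ^ k)"
        unfolding eventually_sequentially
        using close nn_integral_L2_square[OF L2_diff[OF F F]] by (auto intro!: exI[of _ k] ennreal_leI)
    qed simp
    finally show ?thesis .
  qed
  have diff: "(\<lambda>x. F k x - w x) \<in> L2" for k
  proof (rule L2I)
    have "(\<integral>\<^sup>+x. ennreal (norm ((cmod (F k x - w x))\<^sup>2)) \<partial>lborel) < \<infinity>"
      using bound[of k] by (simp add: le_less_trans[OF _ ennreal_less_top])
    then show "integrable lborel (\<lambda>x. (cmod (F k x - w x))\<^sup>2)"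
      by (intro integrableI_bounded) auto
  qed measurable
  show ?thesis
  proof
    show "w \<in> L2" using L2_diff[OF F[of 0] diff[of 0]] by simp
    show "(L2_norm (\<lambda>x. F k x - w x))\<^sup>2 \<le> c * (1 / 4) ^ k" for k
      using bound[of k] c by (simp add: nn_integral_L2_square[OF diff])
  qed
qed

text \<open>A bounded functional on a subspace V is represented by an element w of the closure of V. That w
  is a limit of elements of V is part of the conclusion because it is the source of the density
  theorem below. The representing w minimizes \<open>\<parallel>f\<parallel>\<^sup>2 - 2 Re (T f)\<close>, and the representation is the
  Euler-Lagrange equation of this minimum.\<close>

theorem L2_Riesz_on_subspace:
  fixes V :: "(real^'n \<Rightarrow> complex) set"
  assumes V: "V \<subseteq> L2" "(\<lambda>x. 0) \<in> V"
    and V_add: "\<And>f g. f \<in> V \<Longrightarrow> g \<in> V \<Longrightarrow> (\<lambda>x. f x + g x) \<in> V"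
    and V_scale: "\<And>c f. f \<in> V \<Longrightarrow> (\<lambda>x. c * f x) \<in> V"
    and T_add: "\<And>f g. f \<in> V \<Longrightarrow> g \<in> V \<Longrightarrow> T (\<lambda>x. f x + g x) = T f + T g"
    and T_scale: "\<And>c f. f \<in> V \<Longrightarrow> T (\<lambda>x. c * f x) = c * T f"
    and T_bound: "\<And>f. f \<in> V \<Longrightarrow> cmod (T f) \<le> K * L2_norm f"
  obtains w F where "w \<in> L2" "\<And>k. F k \<in> V" "(\<lambda>k. L2_norm (\<lambda>x. F k x - w x)) \<longlonglongrightarrow> 0"
    "\<And>h. h \<in> V \<Longrightarrow> T h = L2_inner h w"
proof -
  define Q where "Q f = (L2_norm f)\<^sup>2 - 2 * Re (T f)" for f
  define m where "m = Inf (Q ` V)"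
  have VD: "f \<in> L2" if "f \<in> V" for f using that V by auto
  have Q_lower: "- (K\<^sup>2) \<le> Q f" if "f \<in> V" for f
  proof -
    have "Re (T f) \<le> K * L2_norm f"
      using T_bound[OF that] complex_Re_le_cmod[of "T f"] by linarith
    moreover have "0 \<le> (L2_norm f - K)\<^sup>2" by simp
    ultimately show ?thesis by (simp add: Q_def power2_diff mult.commute)
  qed
  have m_le: "m \<le> Q f" if "f \<in> V" for f
    unfolding m_def using that Q_lower by (intro cInf_lower bdd_belowI2[of _ "- (K\<^sup>2)"]) auto
  have "\<exists>f\<in>V. Q f < m + (1 / 4) ^ k" for k
    using cInf_lessD[of "Q ` V" "m + (1 / 4) ^ k"] V(2) unfolding m_def by auto
  then obtain F where F: "F k \<in> V" and QF: "Q (F k) < m + (1 / 4) ^ k" for k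
    by metis
  have parallelogram: "(L2_norm (\<lambda>x. f x - g x))\<^sup>2 \<le> 2 * (Q f - m) + 2 * (Q g - m)"
    if f: "f \<in> V" and g: "g \<in> V" for f g
  proof -
    let ?h = "\<lambda>x. (1 / 2) * (f x + g x)"
    have "m \<le> Q ?h" by (intro m_le V_scale V_add f g)
    moreover have "(L2_norm ?h)\<^sup>2 = (1 / 4) * (L2_norm (\<lambda>x. f x + g x))\<^sup>2"
      by (subst L2_norm_scale) (simp add: power_divide)
    moreover have "Re (T ?h) = (Re (T f) + Re (T g)) / 2"
    proof -
      have "Re (T ?h) = Re ((1 / 2) * (T f + T g))"
        by (simp only: T_scale[OF V_add[OF f g]] T_add[OF f g])
      then show ?thesis by simp
    qed
    ultimately show ?thesis
      using L2_norm_add_square[OF VD[OF f] VD[OF g]] L2_norm_diff_square[OF VD[OF f] VD[OF g]]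
      by (simp add: Q_def)
  qed
  have "(L2_norm (\<lambda>x. F k x - F l x))\<^sup>2 \<le> 4 * (1 / 4) ^ k" if "k \<le> l" for k l
  proof -
    define p q :: real where "p = (1 / 4) ^ k" and "q = (1 / 4) ^ l"
    have "q \<le> p" unfolding p_def q_def using that by (intro power_decreasing) auto
    then have "(L2_norm (\<lambda>x. F k x - F l x))\<^sup>2 \<le> 4 * p"
    proof -
      have "2 * (Q (F k) - m) \<le> 2 * p" "2 * (Q (F l) - m) \<le> 2 * q"
        using QF[of k] QF[of l] by (simp_all add: p_def q_def)
      with parallelogram[OF F F, of k l] \<open>q \<le> p\<close> show ?thesis by linarith
    qed
    then show ?thesis by (simp add: p_def)
  qed
  then obtain w where w: "w \<in> L2" and Fw: "(L2_norm (\<lambda>x. F k x - w x))\<^sup>2 \<le> 4 * (1 / 4) ^ k" for k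
    using L2_complete_geometric[of F 4] VD F by blast
  have lim: "(\<lambda>k. L2_norm (\<lambda>x. F k x - w x)) \<longlonglongrightarrow> 0"
  proof -
    have quarter: "(\<lambda>k. 4 * (1 / 4) ^ k :: real) \<longlonglongrightarrow> 0"
      by (intro tendsto_mult_right_zero LIMSEQ_power_zero) auto
    have "(\<lambda>k. (L2_norm (\<lambda>x. F k x - w x))\<^sup>2) \<longlonglongrightarrow> 0"
      by (rule tendsto_sandwich[OF _ _ tendsto_const quarter]) (use Fw in auto)
    from tendsto_real_sqrt[OF this] show ?thesis by (simp add: L2_norm_nonneg)
  qed
  have "T h = L2_inner h w" if h: "h \<in> V" for h
  proof (rule ccontr)
    assume neq: "T h \<noteq> L2_inner h w"
    define z where "z = T h - L2_inner h w"
    have "(\<lambda>k. L2_inner h (F k)) \<longlonglongrightarrow> L2_inner h w"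
    proof -
      have "cmod (L2_inner h (F k) - L2_inner h w) \<le> L2_norm h * L2_norm (\<lambda>x. F k x - w x)" for k
        using L2_Cauchy_Schwarz[OF VD[OF h] L2_diff[OF VD[OF F] w]]
        by (simp add: L2_inner_diff_right VD F h w)
      from Lim_null_comparison[OF always_eventually[OF allI[OF this]] tendsto_mult_right_zero[OF lim]]
      show ?thesis by (rule LIM_zero_cancel)
    qed
    note inner_lim = this
    \<comment> \<open>First variation in the direction h, with an arbitrary complex step a.\<close>
    have key: "2 * Re (a * z) \<le> (cmod a)\<^sup>2 * (L2_norm h)\<^sup>2" for a
    proof -
      have "2 * Re (a * (T h - L2_inner h (F k))) \<le> (cmod a)\<^sup>2 * (L2_norm h)\<^sup>2 + (1 / 4) ^ k" for k
      proof -
        let ?g = "\<lambda>x. F k x + a * h x"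
        have "m \<le> Q ?g" by (intro m_le V_add V_scale F h)
        moreover have "Q ?g = Q (F k) + 2 * Re (a * L2_inner h (F k)) + (cmod a)\<^sup>2 * (L2_norm h)\<^sup>2 - 2 * Re (a * T h)"
          using L2_norm_add_square[OF VD[OF F] VD[OF V_scale[OF h, of a]]]
          by (simp add: Q_def T_add[OF F V_scale[OF h]] T_scale[OF h] L2_norm_scale L2_inner_scale_left
              power_mult_distrib)
        ultimately show ?thesis using QF[of k] by (simp add: algebra_simps)
      qed
      moreover have "(\<lambda>k. 2 * Re (a * (T h - L2_inner h (F k)))) \<longlonglongrightarrow> 2 * Re (a * z)"
        unfolding z_def by (intro tendsto_intros inner_lim)
      moreover have "(\<lambda>k. (cmod a)\<^sup>2 * (L2_norm h)\<^sup>2 + (1 / 4) ^ k) \<longlonglongrightarrow> (cmod a)\<^sup>2 * (L2_norm h)\<^sup>2 + 0"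
        by (intro tendsto_intros LIMSEQ_power_zero) auto
      ultimately show ?thesis
        using LIMSEQ_le by fastforce
    qed
    \<comment> \<open>The choice a = t * cnj z with a small step t turns the quadratic bound into a contradiction.\<close>
    define t where "t = 1 / ((L2_norm h)\<^sup>2 + 1)"
    have t: "t > 0" by (simp add: t_def add_nonneg_pos)
    have "2 * (t * (cmod z)\<^sup>2) \<le> t\<^sup>2 * (cmod z)\<^sup>2 * (L2_norm h)\<^sup>2"
    proof -
      have "Re (of_real t * cnj z * z) = t * (cmod z)\<^sup>2"
        unfolding cmod_power2 by (simp add: power2_eq_square algebra_simps)
      then show ?thesis using key[of "of_real t * cnj z"] t by (simp add: norm_mult power_mult_distrib)
    qed
    then have "2 \<le> t * (L2_norm h)\<^sup>2"
      using t neq by (simp add: z_def power2_eq_square)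
    also have "\<dots> \<le> 1" by (simp add: t_def divide_le_eq add_nonneg_pos)
    finally show False by simp
  qed
  with w F lim show ?thesis using that by blast
qed

section \<open>Density of the test functions\<close>

lemma smooth_imp_continuous_on: "smooth f \<Longrightarrow> continuous_on S f"
  by (meson smooth_imp_differentiable continuous_at_imp_continuous_on differentiable_imp_continuous_within)

lemma test_fun_L2:
  assumes "f \<in> test_fun"
  shows "f \<in> L2"
proof (rule L2I)
  have cont: "continuous_on S f" for S
    using test_funD(1)[OF assms] by (rule smooth_imp_continuous_on)
  then show "f \<in> borel_measurable lborel"
    using borel_measurable_continuous_onI[of f] by simp
  have "integrable lborel (\<lambda>x. indicator (supp f) x *\<^sub>R (cmod (f x))\<^sup>2)"
    by (intro borel_integrable_compact test_funD(2)[OF assms] continuous_intros cont)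
  moreover have "(\<lambda>x. indicator (supp f) x *\<^sub>R (cmod (f x))\<^sup>2) = (\<lambda>x. (cmod (f x))\<^sup>2)"
    using test_funD(3)[OF assms] by (force simp: indicator_def)
  ultimately show "integrable lborel (\<lambda>x. (cmod (f x))\<^sup>2)" by simp
qed

lemma indicator_box_L2: "indicator (box a b) \<in> (L2 :: (real^'n \<Rightarrow> complex) set)"
proof (rule L2I)
  have "(\<lambda>x::real^'n. (cmod (indicator (box a b) x))\<^sup>2) = indicat_real (box a b)"
    by (auto simp: indicator_def)
  moreover have "integrable lborel (indicat_real (box a b :: (real^'n) set))"
    using emeasure_lborel_box_finite[of a b] by (intro integrable_real_indicator) auto
  ultimately show "integrable lborel (\<lambda>x::real^'n. (cmod (indicator (box a b) x))\<^sup>2)" by simp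
qed simp

text \<open>The bump functions of a box converge boundedly to its indicator, so dominated convergence
  applies.\<close>

lemma integral_box_eq_0_if_orthogonal:
  fixes u :: "real^'n \<Rightarrow> complex"
  assumes u: "u \<in> L2" and orth: "\<And>h. h \<in> test_fun \<Longrightarrow> (LINT x|lborel. h x * u x) = 0"
  shows "(LINT x:box a b|lborel. u x) = 0"
proof -
  have [measurable]: "u \<in> borel_measurable lborel" by (rule L2_measurable, fact)
  have dom: "integrable lborel (\<lambda>x. indicator (box a b) x * u x)"
    by (rule L2_integrable_mult[OF indicator_box_L2 u])
  have "(\<lambda>m. LINT x|lborel. bump a b m x * u x) \<longlonglongrightarrow> (LINT x|lborel. indicator (box a b) x * u x)"
  proof (rule integral_dominated_convergence[where w = "\<lambda>x. norm (indicator (box a b) x * u x)"])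
    show "(\<lambda>x. bump a b m x * u x) \<in> borel_measurable lborel" for m
      using test_fun_L2[OF bump_test_fun[of a b m], THEN L2_measurable] by measurable
    show "AE x in lborel. (\<lambda>m. bump a b m x * u x) \<longlonglongrightarrow> indicator (box a b) x * u x"
      by (intro AE_I2 tendsto_mult bump_tendsto tendsto_const)
    show "AE x in lborel. norm (bump a b m x * u x) \<le> norm (indicator (box a b) x * u x)" for m
    proof (intro AE_I2)
      fix x
      show "norm (bump a b m x * u x) \<le> norm (indicator (box a b) x * u x)"
        using norm_bump_le[of a b m x] bump_outside[of x a b m] mult_right_mono[of "cmod (bump a b m x)" 1 "cmod (u x)"]
        by (cases "x \<in> box a b") (simp_all add: norm_mult)
    qed
  qed (use dom in auto)
  then have "(LINT x|lborel. indicator (box a b) x * u x) = 0"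
    by (simp add: orth[OF bump_test_fun] LIMSEQ_const_iff)
  then show ?thesis
    by (simp add: set_lebesgue_integral_def indicator_scaleR_eq_if indicator_times_eq_if(1))
qed

text \<open>On a fixed box u is integrable, and the sets over which it integrates to zero form a Dynkin
  system that contains all boxes, hence all Borel sets.\<close>

lemma AE_eq_0_if_orthogonal:
  fixes u :: "real^'n \<Rightarrow> complex"
  assumes u: "u \<in> L2" and orth: "\<And>h. h \<in> test_fun \<Longrightarrow> (LINT x|lborel. h x * u x) = 0"
  shows "AE x in lborel. u x = 0"
proof -
  have on_box: "AE x in lborel. indicator (box a b) x *\<^sub>R u x = 0" for a b
  proof (rule sigma_finite_measure.density_zero[OF sigma_finite_lborel])
    let ?g = "\<lambda>x. indicator (box a b) x *\<^sub>R u x"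
    show int: "integrable lborel ?g"
      using L2_integrable_mult[OF indicator_box_L2[of a b] u]
      by (simp add: indicator_scaleR_eq_if indicator_times_eq_if(1))
    then have int_on: "set_integrable lborel A ?g" if "A \<in> sets borel" for A
      using that integrable_mult_indicator[of A lborel ?g] by (simp add: set_integrable_def)
    fix A :: "(real^'n) set" assume A: "A \<in> sets lborel"
    have "Int_stable (range (\<lambda>(a, b). box a b :: (real^'n) set))"
      by (auto simp: Int_stable_def box_Int_box)
    moreover have "range (\<lambda>(a, b). box a b :: (real^'n) set) \<subseteq> Pow UNIV" by auto
    moreover have "A \<in> sigma_sets UNIV (range (\<lambda>(a, b). box a b))"
      using A unfolding sets_lborel borel_eq_box by simp
    ultimately show "(LINT x:A|lborel. ?g x) = 0"
    proof (induction rule: sigma_sets_induct_disjoint)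
      case (basic A)
      then obtain c d where "A = box c d" by auto
      moreover obtain l r :: "real^'n" where "box c d \<inter> box a b = box l r"
        using box_Int_box[of c d a b] by blast
      moreover have "(LINT x:box c d|lborel. ?g x) = (LINT x:box c d \<inter> box a b|lborel. u x)"
        by (simp add: set_lebesgue_integral_def indicator_inter_arith)
      ultimately show ?case using integral_box_eq_0_if_orthogonal[OF u orth] by simp
    next
      case empty
      show ?case by (simp add: set_lebesgue_integral_def)
    next
      case (compl A)
      have A: "A \<in> sets borel" using compl by (simp add: borel_eq_box)
      have "(LINT x:UNIV|lborel. ?g x) = (LINT x:A|lborel. ?g x) + (LINT x:UNIV - A|lborel. ?g x)"
        using set_integral_Un[of A "UNIV - A" lborel ?g] A int_on[of A] int_on[of "UNIV - A"] by auto
      moreover have "(LINT x:UNIV|lborel. ?g x) = (LINT x:box a b|lborel. u x)"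
        by (simp add: set_lebesgue_integral_def)
      ultimately show ?case using compl integral_box_eq_0_if_orthogonal[OF u orth] by simp
    next
      case (union F)
      have F: "F i \<in> sets borel" for i using union by (simp add: borel_eq_box subset_eq)
      have "(LINT x:(\<Union>i. F i)|lborel. ?g x) = (\<Sum>i. (LINT x:F i|lborel. ?g x))"
        using union F by (intro lebesgue_integral_countable_add int_on)
          (auto simp: disjoint_family_on_def)
      then show ?case using union by simp
    qed
  qed
  then have "AE x in lborel. \<forall>n::nat. indicator (box (- (real n *\<^sub>R One)) (real n *\<^sub>R One)) x *\<^sub>R u x = 0"
    unfolding AE_all_countable by blast
  then show ?thesis
  proof eventually_elim
    case (elim x)
    have "x \<in> (\<Union>n::nat. box (- (real n *\<^sub>R One)) (real n *\<^sub>R One))"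
      unfolding UN_box_eq_UNIV by simp
    then obtain n :: nat where "x \<in> box (- (real n *\<^sub>R One)) (real n *\<^sub>R One)" by blast
    then show ?case using elim[rule_format, of n] by simp
  qed
qed

lemma L2_norm_cong_AE:
  "f \<in> L2 \<Longrightarrow> g \<in> L2 \<Longrightarrow> AE x in lborel. f x = g x \<Longrightarrow> L2_norm f = L2_norm g"
  unfolding L2_norm_def
  by (rule arg_cong[where f = sqrt], rule integral_cong_AE)
     (auto dest: L2_integrable_square borel_measurable_integrable)

lemmas test_fun_Riesz =
  L2_Riesz_on_subspace[of test_fun, OF subsetI[OF test_fun_L2] test_fun_zero
    test_fun_add test_fun_scale]

text \<open>The Riesz theorem for the functional \<open>\<lambda>h. L2_inner h f\<close> returns a limit w of test functions; the
  difference of f and w is orthogonal to the test functions and therefore vanishes almost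
  everywhere.\<close>

theorem test_fun_dense_L2:
  assumes f: "f \<in> L2"
  obtains F where "\<And>k. F k \<in> test_fun" "(\<lambda>k. L2_norm (\<lambda>x. f x - F k x)) \<longlonglongrightarrow> 0"
proof -
  obtain w F where w: "w \<in> L2" and F: "\<And>k. F k \<in> test_fun"
    and lim: "(\<lambda>k. L2_norm (\<lambda>x. F k x - w x)) \<longlonglongrightarrow> 0"
    and inner: "\<And>h. h \<in> test_fun \<Longrightarrow> L2_inner h f = L2_inner h w"
  proof (rule test_fun_Riesz[of "\<lambda>h. L2_inner h f" "L2_norm f"])
    show "cmod (L2_inner h f) \<le> L2_norm f * L2_norm h" if "h \<in> test_fun" for h
      using L2_Cauchy_Schwarz[OF test_fun_L2[OF that] f] by (simp add: mult.commute)
  qed (use f in \<open>auto simp: test_fun_L2 L2_inner_add_left L2_inner_scale_left\<close>)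
  have "AE x in lborel. cnj (f x - w x) = 0"
  proof (rule AE_eq_0_if_orthogonal)
    show "(\<lambda>x. cnj (f x - w x)) \<in> L2" by (intro L2_cnj L2_diff f w)
    show "(LINT x|lborel. h x * cnj (f x - w x)) = 0" if "h \<in> test_fun" for h
      using inner[OF that] L2_inner_diff_right[OF f w test_fun_L2[OF that]]
      by (simp add: L2_inner_def)
  qed
  then have eq: "AE x in lborel. F k x - w x = F k x - f x" for k
    by eventually_elim auto
  have "L2_norm (\<lambda>x. F k x - w x) = L2_norm (\<lambda>x. f x - F k x)" for k
    using L2_norm_cong_AE[OF _ _ eq] test_fun_L2[OF F] f w
    by (simp add: L2_diff L2_norm_minus_commute[of f])
  then show ?thesis using that[of F] F lim by simp
qed

lemma bounded_imp_dist_in_L2: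
  assumes "\<And>f g. f \<in> test_fun \<Longrightarrow> g \<in> test_fun \<Longrightarrow> T (\<lambda>x. f x + g x) = T f + T g"
    and "\<And>c f. f \<in> test_fun \<Longrightarrow> T (\<lambda>x. c * f x) = c * T f"
    and "\<And>f. f \<in> test_fun \<Longrightarrow> cmod (T f) \<le> K * L2_norm f"
  shows "dist_in_L2 T"
proof -
  obtain w where w: "w \<in> L2" and "\<And>h. h \<in> test_fun \<Longrightarrow> T h = L2_inner h w"
    by (rule test_fun_Riesz[of T K]) (use assms in auto)
  then have "represents (\<lambda>x. cnj (w x)) T"
    by (simp add: represents_def L2_inner_def mult.commute)
  then show ?thesis using L2_cnj[OF w] by (auto simp: dist_in_L2_def)
qed

text \<open>The pairing of a distribution with test functions is the inner product with its representing
  function, in both slots.\<close>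

lemma L2_rep:
  assumes "dist_in_L2 T"
  shows L2_rep_L2: "L2_rep T \<in> L2"
    and pair_dist_L2_rep: "f \<in> test_fun \<Longrightarrow> pair_dist f T = L2_inner f (L2_rep T)"
    and dist_pair_L2_rep: "f \<in> test_fun \<Longrightarrow> dist_pair T f = L2_inner (L2_rep T) f"
proof -
  have rep: "L2_rep T \<in> L2 \<and> represents (L2_rep T) T"
    using assms unfolding dist_in_L2_def L2_rep_def Bex_def by (rule someI_ex)
  then show "L2_rep T \<in> L2" by blast
  show dist_pair: "dist_pair T f = L2_inner (L2_rep T) f" if "f \<in> test_fun" for f
    using rep test_fun_cnj[OF that] by (simp add: dist_pair_def represents_def L2_inner_def)
  show "pair_dist f T = L2_inner f (L2_rep T)" if "f \<in> test_fun"
    using dist_pair[OF that] L2_inner_commute[of f] by (simp add: pair_dist_def)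
qed

section \<open>Bessel families and their mixed sums\<close>

lemma ennreal_summable_on [simp]: "f summable_on I" for f :: "'i \<Rightarrow> ennreal"
  by (rule nonneg_summable_on_complete) auto

lemma infsum_ennreal_le_iff:
  assumes "\<And>i. 0 \<le> a i" "0 \<le> c"
  shows "(\<Sum>\<^sub>\<infinity>i\<in>I. ennreal (a i)) \<le> ennreal c \<longleftrightarrow> (\<forall>F. finite F \<longrightarrow> F \<subseteq> I \<longrightarrow> sum a F \<le> c)"
  by (subst nonneg_infsum_complete) (auto simp: SUP_le_iff assms sum_ennreal sum_nonneg)

lemma abs_summable_mult_if_square_bounded:
  fixes a b :: "'i \<Rightarrow> complex"
  assumes a: "\<And>F. finite F \<Longrightarrow> F \<subseteq> I \<Longrightarrow> (\<Sum>i\<in>F. (cmod (a i))\<^sup>2) \<le> \<alpha>"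
    and b: "\<And>F. finite F \<Longrightarrow> F \<subseteq> I \<Longrightarrow> (\<Sum>i\<in>F. (cmod (b i))\<^sup>2) \<le> \<beta>"
  shows "(\<lambda>i. cmod (a i * b i)) summable_on I"
    and "cmod (\<Sum>\<^sub>\<infinity>i\<in>I. a i * b i) \<le> sqrt \<alpha> * sqrt \<beta>"
proof -
  have bound: "(\<Sum>i\<in>F. cmod (a i * b i)) \<le> sqrt \<alpha> * sqrt \<beta>" if "finite F" "F \<subseteq> I" for F
  proof -
    have "(\<Sum>i\<in>F. cmod (a i * b i)) \<le> L2_set (\<lambda>i. cmod (a i)) F * L2_set (\<lambda>i. cmod (b i)) F"
      using L2_set_mult_ineq[of "\<lambda>i. cmod (a i)" "\<lambda>i. cmod (b i)" F] by (simp add: norm_mult)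
    also have "\<dots> \<le> sqrt \<alpha> * sqrt \<beta>"
      unfolding L2_set_def using a[OF that] b[OF that] a[of "{}"]
      by (intro mult_mono real_sqrt_le_mono) (auto intro: sum_nonneg)
    finally show ?thesis .
  qed
  show summable: "(\<lambda>i. cmod (a i * b i)) summable_on I"
    by (rule nonneg_bdd_above_summable_on) (auto intro!: bdd_aboveI2 bound)
  have "cmod (\<Sum>\<^sub>\<infinity>i\<in>I. a i * b i) \<le> (\<Sum>\<^sub>\<infinity>i\<in>I. cmod (a i * b i))"
    using summable by (rule norm_infsum_bound)
  also have "\<dots> \<le> sqrt \<alpha> * sqrt \<beta>"
    by (rule infsum_le_finite_sums[OF summable bound])
  finally show "cmod (\<Sum>\<^sub>\<infinity>i\<in>I. a i * b i) \<le> sqrt \<alpha> * sqrt \<beta>" .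
qed

text \<open>The upper frame inequality for arguments in D. Finite partial sums keep it an inequality
  between reals that is visibly closed under limits in f.\<close>

definition Bessel_on ::
  "(real^'n \<Rightarrow> complex) set \<Rightarrow> 'i set \<Rightarrow> ('i \<Rightarrow> real^'n \<Rightarrow> complex) \<Rightarrow> real \<Rightarrow> bool" where
  "Bessel_on D I e C \<longleftrightarrow> 0 < C \<and> (\<forall>i\<in>I. e i \<in> L2) \<and>
     (\<forall>f\<in>D. \<forall>F. finite F \<longrightarrow> F \<subseteq> I \<longrightarrow> (\<Sum>i\<in>F. (cmod (L2_inner f (e i)))\<^sup>2) \<le> C * (L2_norm f)\<^sup>2)"

lemma Bessel_onD:
  assumes "Bessel_on D I e C"
  shows "0 < C" "i \<in> I \<Longrightarrow> e i \<in> L2"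
    "f \<in> D \<Longrightarrow> finite F \<Longrightarrow> F \<subseteq> I \<Longrightarrow> (\<Sum>i\<in>F. (cmod (L2_inner f (e i)))\<^sup>2) \<le> C * (L2_norm f)\<^sup>2"
  using assms by (auto simp: Bessel_on_def)

lemma Bessel_on_subset: "Bessel_on D I e C \<Longrightarrow> D' \<subseteq> D \<Longrightarrow> Bessel_on D' I e C"
  unfolding Bessel_on_def by blast

lemma L2_inner_tendsto:
  assumes "f \<in> L2" "\<And>k. F k \<in> L2" "g \<in> L2"
    and lim: "(\<lambda>k. L2_norm (\<lambda>x. f x - F k x)) \<longlonglongrightarrow> 0"
  shows "(\<lambda>k. L2_inner (F k) g) \<longlonglongrightarrow> L2_inner f g"
proof -
  have "norm (L2_inner f g - L2_inner (F k) g) \<le> L2_norm (\<lambda>x. f x - F k x) * L2_norm g" for k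
    using L2_Cauchy_Schwarz[OF L2_diff[OF assms(1,2)] assms(3)] assms by (simp add: L2_inner_diff_left)
  from Lim_null_comparison[OF always_eventually[OF allI[OF this]] tendsto_mult_left_zero[OF lim]]
  have "(\<lambda>k. L2_inner f g - (L2_inner f g - L2_inner (F k) g)) \<longlonglongrightarrow> L2_inner f g - 0"
    by (intro tendsto_intros)
  then show ?thesis by simp
qed

lemma L2_norm_square_tendsto:
  assumes f: "f \<in> L2" and F: "\<And>k. F k \<in> L2"
    and lim: "(\<lambda>k. L2_norm (\<lambda>x. f x - F k x)) \<longlonglongrightarrow> 0"
  shows "(\<lambda>k. (L2_norm (F k))\<^sup>2) \<longlonglongrightarrow> (L2_norm f)\<^sup>2"
proof -
  have "(L2_norm (F k))\<^sup>2 = (L2_norm (\<lambda>x. f x - F k x))\<^sup>2 - (L2_norm f)\<^sup>2 + 2 * Re (L2_inner (F k) f)" for k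
    using L2_norm_diff_square[OF f F[of k]] by simp
  moreover have "(\<lambda>k. (L2_norm (\<lambda>x. f x - F k x))\<^sup>2 - (L2_norm f)\<^sup>2 + 2 * Re (L2_inner (F k) f)) \<longlonglongrightarrow>
      0\<^sup>2 - (L2_norm f)\<^sup>2 + 2 * Re (L2_inner f f)"
    by (intro tendsto_intros lim L2_inner_tendsto f F)
  moreover have "Re (L2_inner f f) = (L2_norm f)\<^sup>2"
    by (simp flip: L2_norm_square_inner)
  ultimately show ?thesis by simp
qed

text \<open>Each finite partial sum is continuous in f, so density transfers the bound.\<close>

lemma Bessel_on_L2:
  assumes "Bessel_on test_fun I e C"
  shows "Bessel_on L2 I e C"
proof -
  note e = Bessel_onD[OF assms]
  have "(\<Sum>i\<in>F. (cmod (L2_inner f (e i)))\<^sup>2) \<le> C * (L2_norm f)\<^sup>2"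
    if f: "f \<in> L2" and F: "finite F" "F \<subseteq> I" for f F
  proof -
    obtain G where G: "\<And>k. G k \<in> test_fun" and lim: "(\<lambda>k. L2_norm (\<lambda>x. f x - G k x)) \<longlonglongrightarrow> 0"
      using test_fun_dense_L2[OF f] by blast
    show ?thesis
    proof (rule LIMSEQ_le)
      show "(\<lambda>k. \<Sum>i\<in>F. (cmod (L2_inner (G k) (e i)))\<^sup>2) \<longlonglongrightarrow> (\<Sum>i\<in>F. (cmod (L2_inner f (e i)))\<^sup>2)"
        using F e(2) by (intro tendsto_intros L2_inner_tendsto[OF f test_fun_L2[OF G] _ lim]) auto
      show "(\<lambda>k. C * (L2_norm (G k))\<^sup>2) \<longlonglongrightarrow> C * (L2_norm f)\<^sup>2"
        by (intro tendsto_intros L2_norm_square_tendsto[OF f test_fun_L2[OF G] lim])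
    qed (use e(3)[OF G F] in auto)
  qed
  then show ?thesis using e(1,2) by (auto simp: Bessel_on_def)
qed

definition mixed_sum ::
  "'i set \<Rightarrow> ('i \<Rightarrow> real^'n \<Rightarrow> complex) \<Rightarrow> ('i \<Rightarrow> real^'n \<Rightarrow> complex) \<Rightarrow>
     (real^'n \<Rightarrow> complex) \<Rightarrow> (real^'n \<Rightarrow> complex) \<Rightarrow> complex" where
  "mixed_sum I e e' f g = (\<Sum>\<^sub>\<infinity>i\<in>I. L2_inner f (e i) * L2_inner (e' i) g)"

lemma mixed_sum_bounded:
  assumes e: "Bessel_on D I e C" and e': "Bessel_on D I e' C" and f: "f \<in> D" and g: "g \<in> D"
  shows mixed_sum_summable: "(\<lambda>i. cmod (L2_inner f (e i) * L2_inner (e' i) g)) summable_on I"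
    and mixed_sum_bound: "cmod (mixed_sum I e e' f g) \<le> C * L2_norm f * L2_norm g"
proof -
  have "(\<Sum>i\<in>F. (cmod (L2_inner (e' i) g))\<^sup>2) \<le> C * (L2_norm g)\<^sup>2" if "finite F" "F \<subseteq> I" for F
    using Bessel_onD(3)[OF e' g that] by (subst L2_inner_commute) simp
  note * = abs_summable_mult_if_square_bounded[OF Bessel_onD(3)[OF e f] this]
  show "(\<lambda>i. cmod (L2_inner f (e i) * L2_inner (e' i) g)) summable_on I" using *(1) .
  show "cmod (mixed_sum I e e' f g) \<le> C * L2_norm f * L2_norm g"
    using *(2) Bessel_onD(1)[OF e] unfolding mixed_sum_def
    by (simp add: real_sqrt_mult L2_norm_nonneg mult_ac)
qed

lemma mixed_sum_commute: "mixed_sum I e' e g f = cnj (mixed_sum I e e' f g)"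
  unfolding mixed_sum_def infsum_cnj[symmetric]
  by (rule infsum_cong) (simp add: L2_inner_commute[of g] L2_inner_commute[of _ f])

lemma mixed_sum_diff_left:
  assumes e: "Bessel_on L2 I e C" and e': "Bessel_on L2 I e' C"
    and f: "f \<in> L2" and h: "h \<in> L2" and g: "g \<in> L2"
  shows "mixed_sum I e e' (\<lambda>x. f x - h x) g = mixed_sum I e e' f g - mixed_sum I e e' h g"
proof -
  have summable: "(\<lambda>i. L2_inner u (e i) * L2_inner (e' i) g) summable_on I" if "u \<in> L2" for u
    by (rule abs_summable_summable[OF mixed_sum_summable[OF e e' that g]])
  have "mixed_sum I e e' f g =
    (\<Sum>\<^sub>\<infinity>i\<in>I. L2_inner (\<lambda>x. f x - h x) (e i) * L2_inner (e' i) g + L2_inner h (e i) * L2_inner (e' i) g)"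
    unfolding mixed_sum_def
    by (rule infsum_cong) (simp add: L2_inner_diff_left f h Bessel_onD(2)[OF e] left_diff_distrib)
  also have "\<dots> = mixed_sum I e e' (\<lambda>x. f x - h x) g + mixed_sum I e e' h g"
    unfolding mixed_sum_def by (rule infsum_add[OF summable[OF L2_diff[OF f h]] summable[OF h]])
  finally show ?thesis by simp
qed

text \<open>The mixed sum is linear and bounded in its first slot, with constant \<open>C * L2_norm g\<close>; density does
  the rest.\<close>

lemma mixed_sum_extend_left:
  assumes e: "Bessel_on L2 I e C" and e': "Bessel_on L2 I e' C"
    and f: "f \<in> L2" and g: "g \<in> L2"
    and test: "\<And>h. h \<in> test_fun \<Longrightarrow> mixed_sum I e e' h g = \<kappa> * L2_inner h g"
  shows "mixed_sum I e e' f g = \<kappa> * L2_inner f g"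
proof -
  obtain F where F: "\<And>k. F k \<in> test_fun" and lim: "(\<lambda>k. L2_norm (\<lambda>x. f x - F k x)) \<longlonglongrightarrow> 0"
    using test_fun_dense_L2[OF f] by blast
  have "norm (mixed_sum I e e' f g - \<kappa> * L2_inner (F k) g) \<le> C * L2_norm (\<lambda>x. f x - F k x) * L2_norm g" for k
    using mixed_sum_bound[OF e e' L2_diff[OF f test_fun_L2[OF F]] g]
    by (simp add: mixed_sum_diff_left[OF e e' f test_fun_L2[OF F] g] test[OF F])
  moreover have "(\<lambda>k. C * L2_norm (\<lambda>x. f x - F k x) * L2_norm g) \<longlonglongrightarrow> 0"
    by (intro tendsto_mult_left_zero tendsto_mult_right_zero lim)
  ultimately have "(\<lambda>k. mixed_sum I e e' f g - \<kappa> * L2_inner (F k) g) \<longlonglongrightarrow> 0"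
    by (rule Lim_null_comparison[OF always_eventually[OF allI]])
  moreover have "(\<lambda>k. mixed_sum I e e' f g - \<kappa> * L2_inner (F k) g) \<longlonglongrightarrow>
      mixed_sum I e e' f g - \<kappa> * L2_inner f g"
    by (intro tendsto_intros L2_inner_tendsto[OF f test_fun_L2[OF F] g lim])
  ultimately show ?thesis using LIMSEQ_unique by fastforce
qed

text \<open>The first slot is extended while the second one is a test function. Conjugation exchanges the
  slots, so that the same lemma extends the second one.\<close>

lemma mixed_sum_extend:
  fixes \<kappa> :: real
  assumes e: "Bessel_on L2 I e C" and e': "Bessel_on L2 I e' C"
    and test: "\<And>f g. f \<in> test_fun \<Longrightarrow> g \<in> test_fun \<Longrightarrow> mixed_sum I e e' f g = \<kappa> * L2_inner f g"
    and f: "f \<in> L2" and g: "g \<in> L2"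
  shows "mixed_sum I e e' f g = \<kappa> * L2_inner f g"
proof -
  have "mixed_sum I e' e h f = \<kappa> * L2_inner h f" if h: "h \<in> test_fun" for h
    using mixed_sum_extend_left[OF e e' f test_fun_L2[OF h], of "of_real \<kappa>"] test[OF _ h]
      mixed_sum_commute[of I e' e h f] L2_inner_commute[of h f] by simp
  then have "mixed_sum I e' e g f = \<kappa> * L2_inner g f"
    by (rule mixed_sum_extend_left[OF e' e g f])
  then show ?thesis
    using mixed_sum_commute[of I e e' f g] L2_inner_commute[of f g] by simp
qed

text \<open>The upper bound is the Bessel bound. The lower bound, with constant \<open>\<kappa>\<^sup>2 / C\<close>, follows from
  \<open>\<kappa> \<parallel>f\<parallel>\<^sup>2 \<le> (\<Sum> \<bar>\<langle>f, e i\<rangle>\<bar>\<^sup>2)\<^sup>1\<^sup>/\<^sup>2 \<surd>C \<parallel>f\<parallel>\<close>, which is Cauchy-Schwarz for the mixed sum.\<close>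

lemma L2_frame_if_dual:
  assumes e: "Bessel_on L2 I e C" and e': "Bessel_on L2 I e' C" and \<kappa>: "\<kappa> > 0"
    and dual: "\<And>f. f \<in> L2 \<Longrightarrow> cmod (mixed_sum I e e' f f) = \<kappa> * (L2_norm f)\<^sup>2"
  shows "is_L2_frame I e"
  unfolding is_L2_frame_def
proof (intro conjI ballI exI)
  have C: "C > 0" by (rule Bessel_onD(1)[OF e])
  show "0 < \<kappa>\<^sup>2 / C" "0 < C" using \<kappa> C by auto
  show "e i \<in> L2" if "i \<in> I" for i by (rule Bessel_onD(2)[OF e that])
  fix f :: "real^'a \<Rightarrow> complex" assume f: "f \<in> L2"
  let ?s = "\<Sum>\<^sub>\<infinity>i\<in>I. ennreal ((cmod (L2_inner f (e i)))\<^sup>2)"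
  show upper: "?s \<le> ennreal (C * (L2_norm f)\<^sup>2)"
    using Bessel_onD(3)[OF e f] C by (subst infsum_ennreal_le_iff) auto
  show "ennreal (\<kappa>\<^sup>2 / C * (L2_norm f)\<^sup>2) \<le> ?s"
  proof (cases "L2_norm f = 0")
    case False
    define \<sigma> where "\<sigma> = enn2real ?s"
    have s: "?s = ennreal \<sigma>"
      using upper by (auto simp: \<sigma>_def top_unique intro!: ennreal_enn2real[symmetric] le_less_trans[OF upper])
    have \<sigma>: "0 \<le> \<sigma>" by (simp add: \<sigma>_def)
    have "(\<Sum>i\<in>F. (cmod (L2_inner f (e i)))\<^sup>2) \<le> \<sigma>" if "finite F" "F \<subseteq> I" for F
      using infsum_ennreal_le_iff[of "\<lambda>i. (cmod (L2_inner f (e i)))\<^sup>2" \<sigma> I] s \<sigma> that by auto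
    moreover have "(\<Sum>i\<in>F. (cmod (L2_inner (e' i) f))\<^sup>2) \<le> C * (L2_norm f)\<^sup>2" if "finite F" "F \<subseteq> I" for F
      using Bessel_onD(3)[OF e' f that] by (subst L2_inner_commute) simp
    ultimately have "cmod (mixed_sum I e e' f f) \<le> sqrt \<sigma> * sqrt (C * (L2_norm f)\<^sup>2)"
      unfolding mixed_sum_def by (rule abs_summable_mult_if_square_bounded(2))
    then have "\<kappa> * (L2_norm f)\<^sup>2 \<le> sqrt \<sigma> * sqrt C * L2_norm f"
      by (simp add: dual[OF f] real_sqrt_mult L2_norm_nonneg)
    then have "\<kappa> * L2_norm f \<le> sqrt \<sigma> * sqrt C"
      using False L2_norm_nonneg[of f] by (simp add: power2_eq_square mult.assoc[symmetric])
    then have "(\<kappa> * L2_norm f)\<^sup>2 \<le> (sqrt \<sigma> * sqrt C)\<^sup>2"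
      using \<kappa> L2_norm_nonneg[of f] by (intro power_mono) auto
    then have "\<kappa>\<^sup>2 / C * (L2_norm f)\<^sup>2 \<le> \<sigma>"
      using C \<sigma> by (simp add: power_mult_distrib field_simps)
    then show ?thesis by (simp add: s ennreal_leI)
  qed simp
qed

lemma Bessel_on_iff_infsum:
  "Bessel_on D I e C \<longleftrightarrow> 0 < C \<and> (\<forall>i\<in>I. e i \<in> L2) \<and>
    (\<forall>f\<in>D. (\<Sum>\<^sub>\<infinity>i\<in>I. ennreal ((cmod (L2_inner f (e i)))\<^sup>2)) \<le> ennreal (C * (L2_norm f)\<^sup>2))"
  by (auto simp: Bessel_on_def infsum_ennreal_le_iff)

section \<open>Sums over a wavelet system\<close>

text \<open>Extended nonnegative numbers are not a topological group, so the iterated sum is compared with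
  the joint one through finite sets of first indices.\<close>

lemma infsum_Sigma_ennreal:
  fixes f :: "'a \<times> 'b \<Rightarrow> ennreal"
  shows "infsum f (Sigma A B) = (\<Sum>\<^sub>\<infinity>a\<in>A. \<Sum>\<^sub>\<infinity>b\<in>B a. f (a, b))"
proof (rule antisym)
  let ?g = "\<lambda>a. \<Sum>\<^sub>\<infinity>b\<in>B a. f (a, b)"
  have finite: "infsum f (Sigma A' B) = sum ?g A'" if "finite A'" for A'
    using that
  proof induction
    case (insert a A')
    have "Sigma (insert a A') B = Pair a ` B a \<union> Sigma A' B" by auto
    then have "infsum f (Sigma (insert a A') B) = infsum f (Pair a ` B a) + infsum f (Sigma A' B)"
      using insert.hyps by (simp, intro infsum_Un_disjoint ennreal_summable_on) auto
    also have "infsum f (Pair a ` B a) = ?g a"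
      by (subst infsum_reindex) (auto simp: inj_on_def o_def)
    finally show ?case using insert by simp
  qed simp
  show "infsum f (Sigma A B) \<le> infsum ?g A"
  proof (rule infsum_le_finite_sums)
    fix F assume F: "finite F" "F \<subseteq> Sigma A B"
    have "sum f F = infsum f F" using F by simp
    also have "\<dots> \<le> infsum f (Sigma (fst ` F) B)"
      using F by (intro infsum_mono_neutral) force+
    also have "\<dots> = infsum ?g (fst ` F)" using F by (simp add: finite)
    also have "\<dots> \<le> infsum ?g A"
      using F by (intro infsum_mono_neutral) force+
    finally show "sum f F \<le> infsum ?g A" .
  qed simp
  show "infsum ?g A \<le> infsum f (Sigma A B)"
  proof (rule infsum_le_finite_sums)
    fix F assume F: "finite F" "F \<subseteq> A"
    have "sum ?g F = infsum f (Sigma F B)" using F by (simp add: finite)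
    also have "\<dots> \<le> infsum f (Sigma A B)"
      using F by (intro infsum_mono_neutral) auto
    finally show "sum ?g F \<le> infsum f (Sigma A B)" .
  qed simp
qed

lemma fws_infsum_ennreal:
  fixes h :: "nat \<times> (int^'n) + int \<times> nat \<times> (int^'n) \<Rightarrow> ennreal"
  shows "infsum h (fws_index J r s) = (\<Sum>\<^sub>\<infinity>(l, k)\<in>gens r \<times> UNIV. h (Inl (l, k))) +
    (\<Sum>\<^sub>\<infinity>j\<in>{J..}. \<Sum>\<^sub>\<infinity>(l, k)\<in>gens (s j) \<times> UNIV. h (Inr (j, l, k)))"
proof -
  let ?A = "gens r \<times> (UNIV :: (int^'n) set)"
  let ?B = "SIGMA j:{J..}. gens (s j) \<times> (UNIV :: (int^'n) set)"
  have "infsum h (fws_index J r s) = infsum h (Inl ` ?A) + infsum h (Inr ` ?B)"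
    unfolding fws_index_def Plus_def by (intro infsum_Un_disjoint ennreal_summable_on) auto
  also have "infsum h (Inl ` ?A) = (\<Sum>\<^sub>\<infinity>(l, k)\<in>?A. h (Inl (l, k)))"
    by (subst infsum_reindex) (auto simp: o_def case_prod_unfold)
  also have "infsum h (Inr ` ?B) = (\<Sum>\<^sub>\<infinity>j\<in>{J..}. \<Sum>\<^sub>\<infinity>(l, k)\<in>gens (s j) \<times> UNIV. h (Inr (j, l, k)))"
    by (subst infsum_reindex) (auto simp: infsum_Sigma_ennreal o_def case_prod_unfold)
  finally show ?thesis .
qed

lemma fws_abs_summable:
  fixes h :: "nat \<times> (int^'n) + int \<times> nat \<times> (int^'n) \<Rightarrow> complex"
  assumes "(\<lambda>i. cmod (h i)) summable_on fws_index J r s"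
  shows "(\<lambda>(l, k). cmod (h (Inl (l, k)))) summable_on gens r \<times> UNIV"
    and "(\<lambda>(j, l, k). cmod (h (Inr (j, l, k)))) summable_on (SIGMA j:{J..}. gens (s j) \<times> UNIV)"
    and "J \<le> j \<Longrightarrow> (\<lambda>(l, k). cmod (h (Inr (j, l, k)))) summable_on gens (s j) \<times> UNIV"
proof -
  have restrict: "((\<lambda>i. cmod (h i)) \<circ> \<iota>) summable_on A" if "inj_on \<iota> A" "\<iota> ` A \<subseteq> fws_index J r s"
    for A and \<iota> :: "'x \<Rightarrow> _"
    using summable_on_subset_banach[OF assms that(2)] summable_on_reindex[OF that(1)] by blast
  show "(\<lambda>(l, k). cmod (h (Inl (l, k)))) summable_on gens r \<times> UNIV"
    using restrict[of Inl "gens r \<times> UNIV"] by (auto simp: o_def case_prod_unfold fws_index_def)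
  show "(\<lambda>(j, l, k). cmod (h (Inr (j, l, k)))) summable_on (SIGMA j:{J..}. gens (s j) \<times> UNIV)"
    using restrict[of Inr "SIGMA j:{J..}. gens (s j) \<times> UNIV"] by (auto simp: o_def case_prod_unfold fws_index_def)
  show "(\<lambda>(l, k). cmod (h (Inr (j, l, k)))) summable_on gens (s j) \<times> UNIV" if "J \<le> j"
    using restrict[of "\<lambda>(l, k). Inr (j, l, k)" "gens (s j) \<times> UNIV"] that
    by (auto simp: o_def case_prod_unfold fws_index_def inj_on_def)
qed

lemma fws_has_sum:
  fixes h :: "nat \<times> (int^'n) + int \<times> nat \<times> (int^'n) \<Rightarrow> complex"
  assumes "(\<lambda>i. cmod (h i)) summable_on fws_index J r s"
  shows fws_has_sum_levels: "((\<lambda>j. \<Sum>\<^sub>\<infinity>(l, k)\<in>gens (s j) \<times> UNIV. h (Inr (j, l, k))) has_sum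
        (\<Sum>\<^sub>\<infinity>j\<in>{J..}. \<Sum>\<^sub>\<infinity>(l, k)\<in>gens (s j) \<times> UNIV. h (Inr (j, l, k)))) {J..}"
    and fws_infsum: "infsum h (fws_index J r s) = (\<Sum>\<^sub>\<infinity>(l, k)\<in>gens r \<times> UNIV. h (Inl (l, k))) +
        (\<Sum>\<^sub>\<infinity>j\<in>{J..}. \<Sum>\<^sub>\<infinity>(l, k)\<in>gens (s j) \<times> UNIV. h (Inr (j, l, k)))"
proof -
  let ?A = "gens r \<times> (UNIV :: (int^'n) set)"
  let ?B = "SIGMA j:{J..}. gens (s j) \<times> (UNIV :: (int^'n) set)"
  let ?b = "\<lambda>j. \<Sum>\<^sub>\<infinity>(l, k)\<in>gens (s j) \<times> UNIV. h (Inr (j, l, k))"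
  note abs = fws_abs_summable[OF assms]
  have coarse: "(\<lambda>(l, k). h (Inl (l, k))) summable_on ?A"
    by (rule abs_summable_summable) (use abs(1) in \<open>simp add: case_prod_unfold\<close>)
  have "(\<lambda>(j, l, k). h (Inr (j, l, k))) summable_on ?B"
    by (rule abs_summable_summable) (use abs(2) in \<open>simp add: case_prod_unfold\<close>)
  then have fine: "((\<lambda>(j, l, k). h (Inr (j, l, k))) has_sum (\<Sum>\<^sub>\<infinity>(j, l, k)\<in>?B. h (Inr (j, l, k)))) ?B"
    by (rule has_sum_infsum)
  have level: "(\<lambda>(l, k). h (Inr (j, l, k))) summable_on gens (s j) \<times> UNIV" if "J \<le> j" for j
    by (rule abs_summable_summable) (use abs(3)[OF that] in \<open>simp add: case_prod_unfold\<close>)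
  have levels: "(?b has_sum (\<Sum>\<^sub>\<infinity>(j, l, k)\<in>?B. h (Inr (j, l, k)))) {J..}"
    by (rule has_sum_SigmaD[OF fine]) (use has_sum_infsum[OF level] in \<open>auto simp: case_prod_unfold\<close>)
  then have total: "(\<Sum>\<^sub>\<infinity>j\<in>{J..}. ?b j) = (\<Sum>\<^sub>\<infinity>(j, l, k)\<in>?B. h (Inr (j, l, k)))"
    by (rule infsumI)
  show "(?b has_sum (\<Sum>\<^sub>\<infinity>j\<in>{J..}. ?b j)) {J..}"
    using levels total by simp
  have "(h has_sum (\<Sum>\<^sub>\<infinity>(l, k)\<in>?A. h (Inl (l, k)))) (Inl ` ?A)"
    using has_sum_infsum[OF coarse] by (subst has_sum_reindex) (auto simp: o_def case_prod_unfold)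
  moreover have "(h has_sum (\<Sum>\<^sub>\<infinity>j\<in>{J..}. ?b j)) (Inr ` ?B)"
    unfolding total using fine by (subst has_sum_reindex) (auto simp: o_def case_prod_unfold)
  ultimately show "infsum h (fws_index J r s) = (\<Sum>\<^sub>\<infinity>(l, k)\<in>?A. h (Inl (l, k))) + (\<Sum>\<^sub>\<infinity>j\<in>{J..}. ?b j)"
    unfolding fws_index_def Plus_def by (intro infsumI has_sum_Un_disjoint) auto
qed

lemma has_sum_imp_tendsto_intervals:
  fixes J :: int
  assumes "(b has_sum S) {J..}"
  shows "((\<lambda>J'. \<Sum>j\<in>{J..<J'}. b j) \<longlongrightarrow> S) at_top"
proof -
  have "filterlim (\<lambda>J'. {J..<J'}) (finite_subsets_at_top {J..}) at_top"
    unfolding filterlim_finite_subsets_at_top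
  proof (intro allI impI)
    fix X :: "int set" assume X: "finite X \<and> X \<subseteq> {J..}"
    have "eventually (\<lambda>J'. \<forall>x\<in>X. x < J') at_top"
      using X by (intro eventually_ball_finite) (auto intro: eventually_gt_at_top)
    then show "eventually (\<lambda>J'. finite {J..<J'} \<and> X \<subseteq> {J..<J'} \<and> {J..<J'} \<subseteq> {J..}) at_top"
      by eventually_elim (use X in auto)
  qed
  then show ?thesis using assms unfolding has_sum_def by (rule filterlim_compose[rotated])
qed

text \<open>Under absolute convergence over the whole index set, the limit over growing sets of scales
  is the unordered sum.\<close>

lemma dual_frames_in_distributions_iff:
  fixes J :: int and N :: "int \<Rightarrow> real^'n^'n" and r s and \<phi> \<psi> \<phi>' \<psi>'
  defines "c f g i \<equiv> pair_dist f (FWS J N \<phi> \<psi> i) * dist_pair (FWS J N \<phi>' \<psi>' i) g"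
  assumes summable: "\<And>f g. f \<in> test_fun \<Longrightarrow> g \<in> test_fun \<Longrightarrow> (\<lambda>i. cmod (c f g i)) summable_on fws_index J r s"
  shows "dual_frames_in_distributions J N r s \<phi> \<psi> \<phi>' \<psi>' \<longleftrightarrow>
    (\<forall>f\<in>test_fun. \<forall>g\<in>test_fun. infsum (c f g) (fws_index J r s) =
       of_real ((2 * pi) ^ CARD('n)) * L2_inner f g)"
  unfolding dual_frames_in_distributions_def
proof (intro ball_cong refl)
  fix f g :: "real^'n \<Rightarrow> complex" assume f: "f \<in> test_fun" and g: "g \<in> test_fun"
  define a where "a = (\<lambda>(l, k). pair_dist f (dist_affine (N J) k (\<phi> l)) * dist_pair (dist_affine (N J) k (\<phi>' l)) g)"
  define b where "b = (\<lambda>j (l, k). pair_dist f (dist_affine (N j) k (\<psi> j l)) * dist_pair (dist_affine (N j) k (\<psi>' j l)) g)"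
  let ?A = "gens r \<times> (UNIV :: (int^'n) set)" and ?B = "\<lambda>j. gens (s j) \<times> (UNIV :: (int^'n) set)"
  have a_c: "a = (\<lambda>(l, k). c f g (Inl (l, k)))" and b_c: "b j = (\<lambda>(l, k). c f g (Inr (j, l, k)))" for j
    by (simp_all add: a_def b_def c_def FWS_def)
  note abs = fws_abs_summable[OF summable[OF f g]] and sums = fws_has_sum[OF summable[OF f g]]
  have abs_ab: "(\<lambda>i. cmod (a i)) summable_on ?A" "\<forall>j\<ge>J. (\<lambda>i. cmod (b j i)) summable_on ?B j"
    using abs(1,3) by (auto simp: a_c b_c case_prod_unfold)
  have lim: "((\<lambda>J'. infsum a ?A + (\<Sum>j\<in>{J..<J'}. infsum (b j) (?B j))) \<longlongrightarrow>
      infsum (c f g) (fws_index J r s)) at_top"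
    unfolding sums(2) a_c b_c
    by (intro tendsto_intros has_sum_imp_tendsto_intervals sums(1))
  have limit_iff: "((\<lambda>J'. infsum a ?A + (\<Sum>j\<in>{J..<J'}. infsum (b j) (?B j))) \<longlongrightarrow> v) at_top \<longleftrightarrow>
      infsum (c f g) (fws_index J r s) = v" for v
  proof
    assume "((\<lambda>J'. infsum a ?A + (\<Sum>j\<in>{J..<J'}. infsum (b j) (?B j))) \<longlongrightarrow> v) at_top"
    then show "infsum (c f g) (fws_index J r s) = v"
      by (rule tendsto_unique[OF trivial_limit_at_top_linorder lim])
  next
    assume "infsum (c f g) (fws_index J r s) = v"
    then show "((\<lambda>J'. infsum a ?A + (\<Sum>j\<in>{J..<J'}. infsum (b j) (?B j))) \<longlongrightarrow> v) at_top"
      using lim by (rule subst)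
  qed
  show "(let a = (\<lambda>(l, k). pair_dist f (dist_affine (N J) k (\<phi> l)) * dist_pair (dist_affine (N J) k (\<phi>' l)) g);
            b = (\<lambda>j (l, k). pair_dist f (dist_affine (N j) k (\<psi> j l)) * dist_pair (dist_affine (N j) k (\<psi>' j l)) g)
        in (\<lambda>i. cmod (a i)) summable_on ?A \<and>
           (\<forall>j\<ge>J. (\<lambda>i. cmod (b j i)) summable_on ?B j) \<and>
           ((\<lambda>J'. infsum a ?A + (\<Sum>j\<in>{J..<J'}. infsum (b j) (?B j)))
             \<longlongrightarrow> of_real ((2 * pi) ^ CARD('n)) * L2_inner f g) at_top) \<longleftrightarrow>
     infsum (c f g) (fws_index J r s) = of_real ((2 * pi) ^ CARD('n)) * L2_inner f g"
    unfolding Let_def a_def[symmetric] b_def[symmetric] limit_iff using abs_ab by blast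
qed

lemma dual_frames_in_L2_iff:
  fixes J :: int and N :: "int \<Rightarrow> real^'n^'n" and r s and \<phi> \<psi> \<phi>' \<psi>'
  defines "e \<equiv> \<lambda>i. L2_rep (FWS J N \<phi> \<psi> i)" and "e' \<equiv> \<lambda>i. L2_rep (FWS J N \<phi>' \<psi>' i)"
    and "I \<equiv> fws_index J r s"
  shows "dual_frames_in_L2 J N r s \<phi> \<psi> \<phi>' \<psi>' \<longleftrightarrow>
    (\<forall>i\<in>I. dist_in_L2 (FWS J N \<phi> \<psi> i) \<and> dist_in_L2 (FWS J N \<phi>' \<psi>' i)) \<and>
    is_L2_frame I e \<and> is_L2_frame I e' \<and>
    (\<forall>f\<in>L2. \<forall>g\<in>L2. (\<lambda>i. cmod (L2_inner f (e i) * L2_inner (e' i) g)) summable_on I \<and>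
       mixed_sum I e e' f g = of_real ((2 * pi) ^ CARD('n)) * L2_inner f g)"
  unfolding dual_frames_in_L2_def e_def e'_def I_def Let_def mixed_sum_def
  by (intro conj_cong ball_cong refl) (simp add: fws_infsum)

lemma FWS_linear:
  fixes N :: "int \<Rightarrow> real^'n^'n"
  assumes "\<And>j. J \<le> j \<Longrightarrow> invertible (N j)"
    and "\<And>l. l \<in> gens r \<Longrightarrow> \<phi> l \<in> distributions"
    and "\<And>j l. J \<le> j \<Longrightarrow> l \<in> gens (s j) \<Longrightarrow> \<psi> j l \<in> distributions"
    and i: "i \<in> fws_index J r s" and f: "f \<in> test_fun"
  shows FWS_add: "g \<in> test_fun \<Longrightarrow> FWS J N \<phi> \<psi> i (\<lambda>x. f x + g x) = FWS J N \<phi> \<psi> i f + FWS J N \<phi> \<psi> i g"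
    and FWS_scale: "FWS J N \<phi> \<psi> i (\<lambda>x. c * f x) = c * FWS J N \<phi> \<psi> i f"
proof -
  obtain U k T where U: "invertible U" and T: "T \<in> distributions" and FWS: "FWS J N \<phi> \<psi> i = dist_affine U k T"
    using i unfolding fws_index_def
  proof (elim PlusE)
    fix p assume "p \<in> gens r \<times> (UNIV :: (int^'n) set)" "i = Inl p"
    then show thesis
      using that[of "N J" "\<phi> (fst p)" "snd p"] assms(1)[of J] assms(2)[of "fst p"] by (auto simp: FWS_def)
  next
    fix p assume "p \<in> (SIGMA j:{J..}. gens (s j) \<times> (UNIV :: (int^'n) set))" "i = Inr p"
    then show thesis
      using that[of "N (fst p)" "\<psi> (fst p) (fst (snd p))" "snd (snd p)"]
        assms(1)[of "fst p"] assms(3)[of "fst p" "fst (snd p)"] by (auto simp: FWS_def)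
  qed
  have test: "adj_affine U k h \<in> test_fun" if "h \<in> test_fun" for h
    by (rule test_fun_adj_affine[OF U that])
  have "adj_affine U k (\<lambda>x. f x + g x) = (\<lambda>y. adj_affine U k f y + adj_affine U k g y)"
    "adj_affine U k (\<lambda>x. c * f x) = (\<lambda>y. c * adj_affine U k f y)"
    by (simp_all add: adj_affine_def fun_eq_iff algebra_simps)
  then show "g \<in> test_fun \<Longrightarrow> FWS J N \<phi> \<psi> i (\<lambda>x. f x + g x) = FWS J N \<phi> \<psi> i f + FWS J N \<phi> \<psi> i g"
    and "FWS J N \<phi> \<psi> i (\<lambda>x. c * f x) = c * FWS J N \<phi> \<psi> i f"
    using T test f by (simp_all add: FWS dist_affine_def distributions_def)
qed

lemma FWS_square_sum:
  "(\<Sum>\<^sub>\<infinity>(l, k)\<in>gens r \<times> UNIV. ennreal ((cmod (pair_dist f (dist_affine (N J) k (\<phi> l))))\<^sup>2)) +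
   (\<Sum>\<^sub>\<infinity>j\<in>{J..}. \<Sum>\<^sub>\<infinity>(l, k)\<in>gens (s j) \<times> UNIV. ennreal ((cmod (pair_dist f (dist_affine (N j) k (\<psi> j l))))\<^sup>2))
   = (\<Sum>\<^sub>\<infinity>i\<in>fws_index J r s. ennreal ((cmod (pair_dist f (FWS J N \<phi> \<psi> i)))\<^sup>2))"
  unfolding fws_infsum_ennreal by (simp add: FWS_def)

text \<open>The bound (i) for one of the two systems already forces its elements to be square integrable
  functions: a single term of the sum bounds the element as a functional, and the Riesz theorem
  applies.\<close>

lemma FWS_Bessel_iff:
  fixes N :: "int \<Rightarrow> real^'n^'n"
  assumes inv: "\<And>j. J \<le> j \<Longrightarrow> invertible (N j)"
    and \<phi>: "\<And>l. l \<in> gens r \<Longrightarrow> \<phi> l \<in> distributions"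
    and \<psi>: "\<And>j l. J \<le> j \<Longrightarrow> l \<in> gens (s j) \<Longrightarrow> \<psi> j l \<in> distributions" and C: "0 < C"
  shows "(\<forall>f\<in>test_fun.
      (\<Sum>\<^sub>\<infinity>(l, k)\<in>gens r \<times> UNIV. ennreal ((cmod (pair_dist f (dist_affine (N J) k (\<phi> l))))\<^sup>2)) +
      (\<Sum>\<^sub>\<infinity>j\<in>{J..}. \<Sum>\<^sub>\<infinity>(l, k)\<in>gens (s j) \<times> UNIV. ennreal ((cmod (pair_dist f (dist_affine (N j) k (\<psi> j l))))\<^sup>2))
      \<le> ennreal (C * (L2_norm f)\<^sup>2)) \<longleftrightarrow>
    (\<forall>i\<in>fws_index J r s. dist_in_L2 (FWS J N \<phi> \<psi> i)) \<and>
    Bessel_on test_fun (fws_index J r s) (\<lambda>i. L2_rep (FWS J N \<phi> \<psi> i)) C"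
  (is "?L \<longleftrightarrow> ?R")
proof -
  let ?I = "fws_index J r s :: (nat \<times> (int^'n) + int \<times> nat \<times> (int^'n)) set" and ?T = "FWS J N \<phi> \<psi>"
  have L: "?L \<longleftrightarrow> (\<forall>f\<in>test_fun. (\<Sum>\<^sub>\<infinity>i\<in>?I. ennreal ((cmod (pair_dist f (?T i)))\<^sup>2)) \<le> ennreal (C * (L2_norm f)\<^sup>2))"
    unfolding FWS_square_sum ..
  have in_L2: "dist_in_L2 (?T i)" if ?L and i: "i \<in> ?I" for i
  proof (rule bounded_imp_dist_in_L2)
    fix f :: "real^'n \<Rightarrow> complex" assume f: "f \<in> test_fun"
    \<comment> \<open>The pairing conjugates its test function, so the bound for T f is read off at cnj f.\<close>
    let ?h = "\<lambda>x. cnj (f x)"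
    have "(\<Sum>\<^sub>\<infinity>i\<in>?I. ennreal ((cmod (pair_dist ?h (?T i)))\<^sup>2)) \<le> ennreal (C * (L2_norm f)\<^sup>2)"
      using \<open>?L\<close> test_fun_cnj[OF f] unfolding L by (metis L2_norm_cnj)
    then have "(\<Sum>i\<in>F. (cmod (pair_dist ?h (?T i)))\<^sup>2) \<le> C * (L2_norm f)\<^sup>2" if "finite F" "F \<subseteq> ?I" for F
      using that C by (subst (asm) infsum_ennreal_le_iff) auto
    from this[of "{i}"] have "(cmod (?T i f))\<^sup>2 \<le> C * (L2_norm f)\<^sup>2"
      using i by (simp add: pair_dist_def dist_pair_def)
    then have "cmod (?T i f) \<le> sqrt (C * (L2_norm f)\<^sup>2)" by (rule real_le_rsqrt)
    then show "cmod (?T i f) \<le> sqrt C * L2_norm f"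
      by (simp add: real_sqrt_mult L2_norm_nonneg)
  next
    show "?T i (\<lambda>x. f x + g x) = ?T i f + ?T i g" if "f \<in> test_fun" "g \<in> test_fun" for f g
      by (rule FWS_add[OF inv \<phi> \<psi> i that])
    show "?T i (\<lambda>x. c * f x) = c * ?T i f" if "f \<in> test_fun" for c f
      by (rule FWS_scale[OF inv \<phi> \<psi> i that])
  qed
  have "?L \<longleftrightarrow> Bessel_on test_fun ?I (\<lambda>i. L2_rep (?T i)) C" if "\<forall>i\<in>?I. dist_in_L2 (?T i)"
  proof -
    have "(\<Sum>\<^sub>\<infinity>i\<in>?I. ennreal ((cmod (pair_dist f (?T i)))\<^sup>2)) =
        (\<Sum>\<^sub>\<infinity>i\<in>?I. ennreal ((cmod (L2_inner f (L2_rep (?T i))))\<^sup>2))" if "f \<in> test_fun" for f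
      using \<open>\<forall>i\<in>?I. dist_in_L2 (?T i)\<close> that by (intro infsum_cong) (simp add: pair_dist_L2_rep)
    then show ?thesis
      unfolding L Bessel_on_iff_infsum using C that by (auto simp: L2_rep_L2)
  qed
  then show ?thesis using in_L2 by blast
qed

lemma is_L2_frame_imp_Bessel: 
  assumes "is_L2_frame I e"
  obtains B where "\<And>C. B \<le> C \<Longrightarrow> Bessel_on L2 I e C"
proof -
  obtain B where e: "\<forall>i\<in>I. e i \<in> L2" and B: "B > 0"
    "\<forall>f\<in>L2. (\<Sum>\<^sub>\<infinity>i\<in>I. ennreal ((cmod (L2_inner f (e i)))\<^sup>2)) \<le> ennreal (B * (L2_norm f)\<^sup>2)"
    using assms unfolding is_L2_frame_def by blast
  show ?thesis
  proof (rule that[of B])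
    fix C assume "B \<le> C"
    then have "ennreal (B * (L2_norm f)\<^sup>2) \<le> ennreal (C * (L2_norm f)\<^sup>2)" for f
      by (intro ennreal_leI mult_right_mono) auto
    then show "Bessel_on L2 I e C"
      using e B \<open>B \<le> C\<close> unfolding Bessel_on_iff_infsum by (meson less_le_trans order_trans)
  qed
qed

theorem theorem9:
  fixes J :: int
    and N :: "int \<Rightarrow> real^'n^'n"
    and r :: enat and s :: "int \<Rightarrow> enat"
    and \<phi> \<phi>' :: "nat \<Rightarrow> (real^'n \<Rightarrow> complex) \<Rightarrow> complex"
    and \<psi> \<psi>' :: "int \<Rightarrow> nat \<Rightarrow> (real^'n \<Rightarrow> complex) \<Rightarrow> complex"
  assumes "\<And>j. j \<ge> J \<Longrightarrow> invertible (N j)"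
    and "\<And>l. l \<in> gens r \<Longrightarrow> \<phi> l \<in> distributions"
    and "\<And>l. l \<in> gens r \<Longrightarrow> \<phi>' l \<in> distributions"
    and "\<And>j l. j \<ge> J \<Longrightarrow> l \<in> gens (s j) \<Longrightarrow> \<psi> j l \<in> distributions"
    and "\<And>j l. j \<ge> J \<Longrightarrow> l \<in> gens (s j) \<Longrightarrow> \<psi>' j l \<in> distributions"
  shows "dual_frames_in_L2 J N r s \<phi> \<psi> \<phi>' \<psi>' \<longleftrightarrow>
    (\<exists>C>0.
       (\<forall>f\<in>test_fun.
          (\<Sum>\<^sub>\<infinity>(l, k)\<in>gens r \<times> UNIV. ennreal ((cmod (pair_dist f (dist_affine (N J) k (\<phi> l))))\<^sup>2)) +
          (\<Sum>\<^sub>\<infinity>j\<in>{J..}. \<Sum>\<^sub>\<infinity>(l, k)\<in>gens (s j) \<times> UNIV.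
              ennreal ((cmod (pair_dist f (dist_affine (N j) k (\<psi> j l))))\<^sup>2))
          \<le> ennreal (C * (L2_norm f)\<^sup>2)) \<and>
       (\<forall>g\<in>test_fun.
          (\<Sum>\<^sub>\<infinity>(l, k)\<in>gens r \<times> UNIV. ennreal ((cmod (pair_dist g (dist_affine (N J) k (\<phi>' l))))\<^sup>2)) +
          (\<Sum>\<^sub>\<infinity>j\<in>{J..}. \<Sum>\<^sub>\<infinity>(l, k)\<in>gens (s j) \<times> UNIV.
              ennreal ((cmod (pair_dist g (dist_affine (N j) k (\<psi>' j l))))\<^sup>2))
          \<le> ennreal (C * (L2_norm g)\<^sup>2))) \<and>
    dual_frames_in_distributions J N r s \<phi> \<psi> \<phi>' \<psi>'"
  (is "?L2 \<longleftrightarrow> (\<exists>C>0. ?bound C \<and> ?bound' C) \<and> ?D")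
proof -
  define I :: "(nat \<times> (int^'n) + int \<times> nat \<times> (int^'n)) set" where "I = fws_index J r s"
  define e where "e i = L2_rep (FWS J N \<phi> \<psi> i)" for i
  define e' where "e' i = L2_rep (FWS J N \<phi>' \<psi>' i)" for i
  define \<kappa> :: real where "\<kappa> = (2 * pi) ^ CARD('n)"
  let ?in = "\<forall>i\<in>I. dist_in_L2 (FWS J N \<phi> \<psi> i) \<and> dist_in_L2 (FWS J N \<phi>' \<psi>' i)"
  have bound: "?bound C \<longleftrightarrow> (\<forall>i\<in>I. dist_in_L2 (FWS J N \<phi> \<psi> i)) \<and> Bessel_on test_fun I e C" if "C > 0" for C
    unfolding I_def e_def[abs_def] by (rule FWS_Bessel_iff[OF assms(1,2,4) that])
  have bound': "?bound' C \<longleftrightarrow> (\<forall>i\<in>I. dist_in_L2 (FWS J N \<phi>' \<psi>' i)) \<and> Bessel_on test_fun I e' C" if "C > 0" for C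
    unfolding I_def e'_def[abs_def] by (rule FWS_Bessel_iff[OF assms(1,3,5) that])
  have L2_iff: "?L2 \<longleftrightarrow> ?in \<and> is_L2_frame I e \<and> is_L2_frame I e' \<and>
      (\<forall>f\<in>L2. \<forall>g\<in>L2. (\<lambda>i. cmod (L2_inner f (e i) * L2_inner (e' i) g)) summable_on I \<and>
         mixed_sum I e e' f g = \<kappa> * L2_inner f g)"
    unfolding I_def e_def[abs_def] e'_def[abs_def] \<kappa>_def by (rule dual_frames_in_L2_iff)
  have D_iff: "?D \<longleftrightarrow> (\<forall>f\<in>test_fun. \<forall>g\<in>test_fun. mixed_sum I e e' f g = \<kappa> * L2_inner f g)"
    if "?in" and e: "Bessel_on test_fun I e C" and e': "Bessel_on test_fun I e' C" for C
  proof -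
    have pairing: "pair_dist f (FWS J N \<phi> \<psi> i) * dist_pair (FWS J N \<phi>' \<psi>' i) g =
        L2_inner f (e i) * L2_inner (e' i) g" if "f \<in> test_fun" "g \<in> test_fun" "i \<in> I" for f g i
      using \<open>?in\<close> that by (simp add: e_def e'_def pair_dist_L2_rep dist_pair_L2_rep)
    have "(\<lambda>i. cmod (pair_dist f (FWS J N \<phi> \<psi> i) * dist_pair (FWS J N \<phi>' \<psi>' i) g)) summable_on I"
      if "f \<in> test_fun" "g \<in> test_fun" for f g
      using mixed_sum_summable[OF e e' that] pairing[OF that] by (simp cong: summable_on_cong)
    from dual_frames_in_distributions_iff[OF this[unfolded I_def], folded I_def]
    show ?thesis
      using pairing by (simp add: mixed_sum_def \<kappa>_def cong: infsum_cong)
  qed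
  show ?thesis
  proof
    assume L2: ?L2
    then have "is_L2_frame I e" "is_L2_frame I e'" and "in": ?in
      and dual: "\<And>f g. f \<in> L2 \<Longrightarrow> g \<in> L2 \<Longrightarrow> mixed_sum I e e' f g = \<kappa> * L2_inner f g"
      unfolding L2_iff by auto
    then obtain B B' where B: "\<And>C. B \<le> C \<Longrightarrow> Bessel_on L2 I e C" "\<And>C. B' \<le> C \<Longrightarrow> Bessel_on L2 I e' C"
      by (metis is_L2_frame_imp_Bessel)
    define C where "C = max B B'"
    have C: "Bessel_on test_fun I e C" "Bessel_on test_fun I e' C"
      using B[of C] test_fun_L2 Bessel_on_subset[of L2 I _ C test_fun] by (auto simp: C_def)
    have "C > 0" by (rule Bessel_onD(1)[OF C(1)])
    moreover have "?bound C \<and> ?bound' C"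
      unfolding bound[OF \<open>C > 0\<close>] bound'[OF \<open>C > 0\<close>] using "in" C by blast
    moreover have ?D
      unfolding D_iff[OF "in" C] using dual test_fun_L2 by blast
    ultimately show "(\<exists>C>0. ?bound C \<and> ?bound' C) \<and> ?D" by blast
  next
    assume "(\<exists>C>0. ?bound C \<and> ?bound' C) \<and> ?D"
    then obtain C where C: "C > 0" "?bound C" "?bound' C" and D: ?D by blast
    then have "in": ?in and test: "Bessel_on test_fun I e C" "Bessel_on test_fun I e' C"
      using bound[OF C(1)] bound'[OF C(1)] by blast+
    then have e: "Bessel_on L2 I e C" and e': "Bessel_on L2 I e' C"
      by (auto intro: Bessel_on_L2)
    have dual: "mixed_sum I e e' f g = \<kappa> * L2_inner f g" if "f \<in> L2" "g \<in> L2" for f g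
      using mixed_sum_extend[OF e e' _ that] D unfolding D_iff[OF "in" test] by blast
    have "\<kappa> > 0" by (simp add: \<kappa>_def)
    have norm: "cmod (mixed_sum I e e' f f) = \<kappa> * (L2_norm f)\<^sup>2" if "f \<in> L2" for f
      using dual[OF that that] \<open>\<kappa> > 0\<close> by (simp add: norm_mult norm_power flip: L2_norm_square_inner)
    have "is_L2_frame I e"
      by (rule L2_frame_if_dual[OF e e' \<open>\<kappa> > 0\<close> norm])
    moreover have "is_L2_frame I e'"
      by (rule L2_frame_if_dual[OF e' e \<open>\<kappa> > 0\<close>]) (use norm mixed_sum_commute[of I e' e] in simp)
    ultimately show ?L2
      unfolding L2_iff using "in" dual mixed_sum_summable[OF e e'] by blast
  qed
qed

end
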